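(* There exists a constant $C$, independent of $n$ and $\tau$, such that the following holds for every $n\in\{2,3,\ldots\}$ and every $\tau>0$. Let $\mathbf{x}^*\in\mathcal{A}_n$ satisfy $\mathcal{E}_\tau[\mathbf{x}^*]=\inf_{\mathbf{x}\in\mathcal{A}_n}\mathcal{E}_\tau[\mathbf{x}]$. Then $$\mathcal{E}_\tau[\mathbf{x}^*]\le\min\left\{Cn^2\tau^2,\ \mathcal{F}\right\}.$$
   Context: Fix $0<r_0<1$ and let $B=\{(x,y)\in\mathbb{R}^2:\ r_0<\sqrt{x^2+y^2}<1\}$, with polar coordinates $(r,\theta)$. Fix a Poisson ratio $\nu$ ($-1<\nu\le 1/2$). The admissible set is $\mathcal{A}=W^{1,2}(B,\mathbb{R}^2)\times W^{2,2}(B,\mathbb{R})$; an element $\mathbf{x}=(\chi,\eta)\in\mathcal{A}$ is called a deformation with in-plane displacement $\chi$ and out-of-plane displacement $\eta$. The in-plane strain is the symmetric matrix field $$\gamma=(D\chi)^T+D\chi+(D\eta)^T D\eta-\mathbf{g}_1,\qquad \mathbf{g}_1=\frac13\begin{pmatrix}y^2&-xy\\-xy&x^2\end{pmatrix},$$ where $D\eta$ is the row vector of first derivatives. The energies are $$\mathcal{S}[\mathbf{x}]=\int_B\Big(\frac{1}{1-\nu}\mathrm{tr}(\gamma)^2-2\det\gamma\Big)\,dx\,dy,\quad \mathcal{B}[\mathbf{x}]=\int_B\Big(\frac{1}{1-\nu}\mathrm{tr}(D^2\eta)^2-2\det(D^2\eta)\Big)\,dx\,dy,\quad \mathcal{E}_\tau=\mathcal{S}+\tau^2\mathcal{B}.$$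 For $n\in\{2,3,\ldots\}$, $\mathcal{A}_n\subset\mathcal{A}$ is the set of $(\chi,\eta)\in\mathcal{A}$ such that, in polar coordinates, (i) $\eta$ is periodic in $\theta$ with period $2\pi/n$; (ii) $\eta$ vanishes along the lines $\theta=0$ and $\theta=\pi/n$; (iii) $\eta(r,\theta-\pi/n)=-\eta(r,\theta)$. The set of flat deformations is $\mathcal{A}_f=\{(\chi,\eta)\in\mathcal{A}:\eta=0\}$, and $\mathcal{F}=\inf_{\mathbf{x}\in\mathcal{A}_f}\mathcal{E}_\tau[\mathbf{x}]$ (which does not depend on $\tau$). Constants may depend on the fixed parameters $r_0$ and $\nu$. *)

theory Defs
  imports "HOL-Analysis.Analysis"
begin

section \<open>Weak derivatives and Sobolev spaces on subsets of the plane\<close>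

fun C_k :: "nat \<Rightarrow> (real^2 \<Rightarrow> real) \<Rightarrow> bool" where
  "C_k 0 f \<longleftrightarrow> continuous_on UNIV f"
| "C_k (Suc k) f \<longleftrightarrow> (\<forall>x. f differentiable (at x)) \<and>
     (\<forall>j. C_k k (\<lambda>x. frechet_derivative f (at x) (axis j 1)))"

definition test_function :: "(real^2) set \<Rightarrow> (real^2 \<Rightarrow> real) \<Rightarrow> bool" where
  "test_function B \<phi> \<longleftrightarrow> (\<forall>k. C_k k \<phi>) \<and>
     compact (closure {x. \<phi> x \<noteq> 0}) \<and> closure {x. \<phi> x \<noteq> 0} \<subseteq> B"

definition locally_integrable_on :: "(real^2 \<Rightarrow> real) \<Rightarrow> (real^2) set \<Rightarrow> bool" where
  "locally_integrable_on f B \<longleftrightarrow> (\<forall>K. compact K \<and> K \<subseteq> B \<longrightarrow> set_integrable lebesgue K f)"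

definition has_weak_partial ::
  "(real^2) set \<Rightarrow> (real^2 \<Rightarrow> real) \<Rightarrow> 2 \<Rightarrow> (real^2 \<Rightarrow> real) \<Rightarrow> bool" where
  "has_weak_partial B f j g \<longleftrightarrow> locally_integrable_on f B \<and> locally_integrable_on g B \<and>
     (\<forall>\<phi>. test_function B \<phi> \<longrightarrow>
        (LINT x:B|lebesgue. f x * frechet_derivative \<phi> (at x) (axis j 1)) =
        - (LINT x:B|lebesgue. g x * \<phi> x))"

text \<open>On an open set, the weak partial derivative is unique only up to a null set;
  \<open>weak_partial\<close> selects an arbitrary representative. Below it is used only under integrals,
  where the choice is immaterial.\<close>

definition weak_partial ::
  "(real^2) set \<Rightarrow> 2 \<Rightarrow> (real^2 \<Rightarrow> real) \<Rightarrow> real^2 \<Rightarrow> real" where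
  "weak_partial B j f = (SOME g. has_weak_partial B f j g)"

definition L2_on :: "(real^2) set \<Rightarrow> (real^2 \<Rightarrow> real) \<Rightarrow> bool" where
  "L2_on B f \<longleftrightarrow> set_borel_measurable lebesgue B f \<and> set_integrable lebesgue B (\<lambda>x. (f x)\<^sup>2)"

definition W12 :: "(real^2) set \<Rightarrow> (real^2 \<Rightarrow> real) set" where
  "W12 B = {f. L2_on B f \<and> (\<forall>j. \<exists>g. has_weak_partial B f j g \<and> L2_on B g)}"

definition W22 :: "(real^2) set \<Rightarrow> (real^2 \<Rightarrow> real) set" where
  "W22 B = {f. L2_on B f \<and> (\<forall>j. \<exists>g. has_weak_partial B f j g \<and> g \<in> W12 B)}"

definition weak_jacobian :: "(real^2) set \<Rightarrow> (real^2 \<Rightarrow> real^'m) \<Rightarrow> real^2 \<Rightarrow> real^2^'m" where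
  "weak_jacobian B u x = (\<chi> i j. weak_partial B j (\<lambda>y. u y $ i) x)"

definition weak_gradient :: "(real^2) set \<Rightarrow> (real^2 \<Rightarrow> real) \<Rightarrow> real^2 \<Rightarrow> real^2^1" where
  "weak_gradient B f x = rowvector (\<chi> j. weak_partial B j f x)"

definition weak_hessian :: "(real^2) set \<Rightarrow> (real^2 \<Rightarrow> real) \<Rightarrow> real^2 \<Rightarrow> real^2^2" where
  "weak_hessian B f x = (\<chi> i j. weak_partial B j (weak_partial B i f) x)"


section \<open>Deformations of the annulus and their elastic energy\<close>

definition annulus :: "real \<Rightarrow> (real^2) set" where
  "annulus r0 = {x. r0 < norm x \<and> norm x < 1}"

definition polar :: "real \<Rightarrow> real \<Rightarrow> real^2" where
  "polar r \<theta> = vector [r * cos \<theta>, r * sin \<theta>]"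

type_synonym deformation = "(real^2 \<Rightarrow> real^2) \<times> (real^2 \<Rightarrow> real)"

text \<open>Sobolev functions are represented by everywhere defined functions, not by classes modulo
  null sets. Values outside the annulus are irrelevant.\<close>

definition admissible :: "real \<Rightarrow> deformation set" where
  "admissible r0 = {(u, \<eta>). (\<forall>i. (\<lambda>x. u x $ i) \<in> W12 (annulus r0)) \<and> \<eta> \<in> W22 (annulus r0)}"

definition metric_g1 :: "real^2 \<Rightarrow> real^2^2" where
  "metric_g1 x = (1/3) *\<^sub>R vector [vector [(x$2)\<^sup>2, - (x$1 * x$2)],
                                   vector [- (x$1 * x$2), (x$1)\<^sup>2]]"

definition strain :: "real \<Rightarrow> deformation \<Rightarrow> real^2 \<Rightarrow> real^2^2" where
  "strain r0 = (\<lambda>(u, \<eta>) x.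
     transpose (weak_jacobian (annulus r0) u x) + weak_jacobian (annulus r0) u x
     + transpose (weak_gradient (annulus r0) \<eta> x) ** weak_gradient (annulus r0) \<eta> x
     - metric_g1 x)"

text \<open>Both densities below are integrable for admissible deformations: the squared gradient
  term of the strain is in $L^2$ because $W^{1,2}$ embeds into $L^4$ in two dimensions. So the
  convention that a non-integrable function has integral 0 plays no role.\<close>

definition elastic_density :: "real \<Rightarrow> real^2^2 \<Rightarrow> real" where
  "elastic_density \<nu> A = 1 / (1 - \<nu>) * (trace A)\<^sup>2 - 2 * det A"

definition stretching_energy :: "real \<Rightarrow> real \<Rightarrow> deformation \<Rightarrow> real" where
  "stretching_energy r0 \<nu> d =
     (LINT x:annulus r0|lebesgue. elastic_density \<nu> (strain r0 d x))"

definition bending_energy :: "real \<Rightarrow> real \<Rightarrow> deformation \<Rightarrow> real" where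
  "bending_energy r0 \<nu> = (\<lambda>(u, \<eta>).
     LINT x:annulus r0|lebesgue. elastic_density \<nu> (weak_hessian (annulus r0) \<eta> x))"

definition energy :: "real \<Rightarrow> real \<Rightarrow> real \<Rightarrow> deformation \<Rightarrow> real" where
  "energy r0 \<nu> \<tau> d = stretching_energy r0 \<nu> d + \<tau>\<^sup>2 * bending_energy r0 \<nu> d"

text \<open>The pointwise symmetry conditions are imposed on the continuous representative \<open>h\<close> of
  \<open>\<eta>\<close>, which exists (and is unique on the annulus) since $W^{2,2}$ embeds into the continuous
  functions.\<close>

definition periodic_admissible :: "real \<Rightarrow> nat \<Rightarrow> deformation set" where
  "periodic_admissible r0 n = {(u, \<eta>). (u, \<eta>) \<in> admissible r0 \<and>
     (\<exists>h. continuous_on (annulus r0) h \<and>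
          (AE x in lebesgue. x \<in> annulus r0 \<longrightarrow> \<eta> x = h x) \<and>
          (\<forall>r \<theta>. r0 < r \<and> r < 1 \<longrightarrow>
             h (polar r (\<theta> + 2 * pi / real n)) = h (polar r \<theta>) \<and>
             h (polar r 0) = 0 \<and> h (polar r (pi / real n)) = 0 \<and>
             h (polar r (\<theta> - pi / real n)) = - h (polar r \<theta>)))}"

definition flat_admissible :: "real \<Rightarrow> deformation set" where
  "flat_admissible r0 = {(u, \<eta>). (u, \<eta>) \<in> admissible r0 \<and>
     (AE x in lebesgue. x \<in> annulus r0 \<longrightarrow> \<eta> x = 0)}"

text \<open>The argument \<open>\<tau>\<close> is immaterial, as flat deformations have no bending energy.\<close>

definition flat_energy :: "real \<Rightarrow> real \<Rightarrow> real \<Rightarrow> real" where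
  "flat_energy r0 \<nu> \<tau> = (INF d\<in>flat_admissible r0. energy r0 \<nu> \<tau> d)"

end

theory Submission
  imports Defs
begin

text \<open>
  Both bounds follow from comparison with a single deformation, as flat deformations are periodic
  and all energies are nonnegative. The bound by $C n^2\tau^2$ needs a deformation without any
  stretching. With $\alpha = \pi/n$, let $\eta$ be the quadratic form
  $y (x - y \cot\alpha)$ on the sector $0 \le \theta \le \alpha$, whose Hessian has determinant
  $-1$ and which vanishes on the two boundary rays, and extend $\eta$ by odd reflection in the
  rays $\theta = k\alpha$. The result is $C^{1,1}$ away from the origin. With the in-plane
  displacement $\chi = -\frac13\, \eta \nabla\eta$ the strain vanishes almost everywhere: for a
  quadratic form $\eta$ with Hessian $H$,
  $\nabla\eta \otimes \nabla\eta - 2 \eta H = -\det H \cdot x^\perp \otimes x^\perp$.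
  The bending energy is of order $\cot^2\alpha \le n^2$.

  Almost everywhere defined pointwise derivatives of locally Lipschitz functions are weak
  derivatives, because difference quotients of a compactly supported function integrate to zero.
  Weak derivatives are unique, because products of one-dimensional bump functions approximate
  indicators of boxes; for such products mixed partial derivatives commute visibly, so weak
  Hessians are symmetric almost everywhere, which makes the bending energy nonnegative.
\<close>

subsection \<open>Smooth bump functions\<close>

text \<open>The displacement and the determinant are forced. For \<chi> = -t \<eta> \<nabla>\<eta>
  the strain is (1 - 2t) \<nabla>\<eta> \<otimes> \<nabla>\<eta> - 2t \<eta> H - g1, which meets the
  combination \<nabla>\<eta> \<otimes> \<nabla>\<eta> - 2 \<eta> H exactly when 1 - 2t = t, so t =
  1/3. The remaining factor 1/3 is the one in g1, whence det H = -1; a form with this determinant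
  that vanishes on two given rays is unique up to sign. On a sector its angular profile is sin s
  sin(\<alpha> - s) / sin \<alpha>, with end slopes 1 and -1. Odd reflection therefore matches
  slopes, and only second derivatives can jump: the gradient stays Lipschitz, so no bending
  concentrates on the rays. Two obstacles shape the rest. The energies are built from arbitrarily
  selected representatives of weak derivatives, so pointwise computations enter only through almost
  everywhere uniqueness. And a real infimum is a lower bound only for a set bounded below, so
  nonnegativity, and with it symmetry of the weak Hessian, is required for every admissible
  deformation and not just for the explicit one.\<close>

fun C_k_real :: "nat \<Rightarrow> (real \<Rightarrow> real) \<Rightarrow> bool" where
  "C_k_real 0 u \<longleftrightarrow> True"
| "C_k_real (Suc k) u \<longleftrightarrow> (\<exists>u'. (\<forall>t. (u has_real_derivative u' t) (at t)) \<and> C_k_real k u')"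

lemma C_k_real_SucI:
  assumes "\<And>t. (u has_real_derivative u' t) (at t)" "C_k_real k u'"
  shows "C_k_real (Suc k) u"
  using assms C_k_real.simps(2) by blast

lemma C_k_real_SucE:
  assumes "C_k_real (Suc k) u"
  obtains u' where "\<forall>t. (u has_real_derivative u' t) (at t)" "C_k_real k u'"
proof -
  from assms obtain u' where "\<forall>t. (u has_real_derivative u' t) (at t)" "C_k_real k u'"
    by auto
  then show thesis using that[of u'] by blast
qed

declare C_k_real.simps(2) [simp del]

lemma C_k_real_SucD: "C_k_real (Suc k) u \<Longrightarrow> C_k_real k u"
proof (induction k arbitrary: u)
  case (Suc k)
  then show ?case by (metis C_k_real_SucE C_k_real_SucI)
qed simp

lemma C_k_real_const: "C_k_real k (\<lambda>_. c)"
  by (induction k arbitrary: c) (auto intro: C_k_real_SucI[OF DERIV_const])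

lemma C_k_real_affine: "C_k_real k (\<lambda>t. c * t + d)"
proof (cases k)
  case (Suc m)
  have "((\<lambda>t. c * t + d) has_real_derivative c) (at t)" for t
    by (auto intro!: derivative_eq_intros)
  then show ?thesis unfolding Suc using C_k_real_const by (rule C_k_real_SucI)
qed simp

lemma C_k_real_add: "C_k_real k u \<Longrightarrow> C_k_real k v \<Longrightarrow> C_k_real k (\<lambda>t. u t + v t)"
proof (induction k arbitrary: u v)
  case (Suc k)
  obtain u' where u: "\<forall>t. (u has_real_derivative u' t) (at t)" "C_k_real k u'"
    using Suc.prems(1) by (rule C_k_real_SucE)
  obtain v' where v: "\<forall>t. (v has_real_derivative v' t) (at t)" "C_k_real k v'"
    using Suc.prems(2) by (rule C_k_real_SucE)
  show ?case
    by (rule C_k_real_SucI[OF DERIV_add[OF u(1)[rule_format] v(1)[rule_format]] Suc.IH[OF u(2) v(2)]])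
qed simp

lemma C_k_real_mult: "C_k_real k u \<Longrightarrow> C_k_real k v \<Longrightarrow> C_k_real k (\<lambda>t. u t * v t)"
proof (induction k arbitrary: u v)
  case (Suc k)
  obtain u' where u: "\<forall>t. (u has_real_derivative u' t) (at t)" "C_k_real k u'"
    using Suc.prems(1) by (rule C_k_real_SucE)
  obtain v' where v: "\<forall>t. (v has_real_derivative v' t) (at t)" "C_k_real k v'"
    using Suc.prems(2) by (rule C_k_real_SucE)
  have "C_k_real k (\<lambda>t. u' t * v t + v' t * u t)"
    by (rule C_k_real_add[OF Suc.IH[OF u(2) C_k_real_SucD[OF Suc.prems(2)]]
          Suc.IH[OF v(2) C_k_real_SucD[OF Suc.prems(1)]]])
  then show ?case
    by (rule C_k_real_SucI[OF DERIV_mult[OF u(1)[rule_format] v(1)[rule_format]]])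
qed simp

lemma C_k_real_compose: "C_k_real k u \<Longrightarrow> C_k_real k v \<Longrightarrow> C_k_real k (\<lambda>t. u (v t))"
proof (induction k arbitrary: u)
  case (Suc k)
  obtain u' where u: "\<forall>t. (u has_real_derivative u' t) (at t)" "C_k_real k u'"
    using Suc.prems(1) by (rule C_k_real_SucE)
  obtain v' where v: "\<forall>t. (v has_real_derivative v' t) (at t)" "C_k_real k v'"
    using Suc.prems(2) by (rule C_k_real_SucE)
  have "C_k_real k (\<lambda>t. u' (v t) * v' t)"
    by (rule C_k_real_mult[OF Suc.IH[OF u(2) C_k_real_SucD[OF Suc.prems(2)]] v(2)])
  then show ?case
    by (rule C_k_real_SucI[OF DERIV_chain2[OF u(1)[rule_format] v(1)[rule_format]]])
qed simp

text \<open>For m = 0 this is the classical smooth function that is flat at the origin. The powers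
  of 1/t are built in because differentiation produces them: the linear span of the family is closed
  under derivatives, so smoothness is a plain induction.\<close>

definition flat_exp :: "nat \<Rightarrow> real \<Rightarrow> real" where
  "flat_exp m t = (if t > 0 then (1/t) ^ m * exp (- (1/t)) else 0)"

text \<open>With x = 1/t, a single term of the exponential series bounds x^(m+2) by (m+2)! exp x.
  Two powers more than m make the bound quadratic in t, so that the difference quotient at 0 tends
  to 0.\<close>

lemma flat_exp_le: "\<bar>flat_exp m t\<bar> \<le> fact (m + 2) * t\<^sup>2"
proof (cases "t > 0")
  case True
  define x where "x = 1 / t"
  have x: "x > 0" using True by (simp add: x_def)
  have "x ^ (m + 2) / fact (m + 2) \<le> exp x"
  proof -
    have "(\<Sum>i\<in>{m+2}. inverse (fact i) * x ^ i) \<le> (\<Sum>i. inverse (fact i) * x ^ i)"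
      using x by (intro sum_le_suminf summable_exp) auto
    then show ?thesis
      by (simp add: exp_def field_simps scaleR_conv_of_real)
  qed
  then have "x ^ m * exp (- x) \<le> fact (m + 2) / x\<^sup>2"
  proof -
    assume "x ^ (m + 2) / fact (m + 2) \<le> exp x"
    moreover obtain c :: real where c: "c = fact (m + 2)" "c > 0" using fact_gt_zero by blast
    ultimately have "x ^ m * x\<^sup>2 \<le> c * exp x"
      by (simp add: divide_le_eq mult.commute flip: power_add del: fact_Suc)
    then show ?thesis
      unfolding c(1)[symmetric] using x by (simp add: exp_minus field_simps)
  qed
  then show ?thesis using True x by (simp add: flat_exp_def x_def power_divide)
qed (simp add: flat_exp_def)

lemma flat_exp_deriv:
  "(flat_exp m has_real_derivative (flat_exp (m+2) t + - real m * flat_exp (m+1) t)) (at t)"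
proof -
  consider "t > 0" | "t < 0" | "t = 0" by linarith
  then show ?thesis
  proof cases
    case 1
    have "((\<lambda>t. (1/t) ^ m * exp (- (1/t))) has_real_derivative
       (flat_exp (m+2) t + - real m * flat_exp (m+1) t)) (at t)"
    proof -
      have i: "((\<lambda>t. 1/t) has_real_derivative - ((1/t)^2)) (at t)"
        using 1 by (auto intro!: derivative_eq_intros simp: field_simps power2_eq_square)
      have "((\<lambda>t. (1/t) ^ m) has_real_derivative - real m * (1/t) ^ (m+1)) (at t)"
        by (rule DERIV_cong[OF DERIV_power[OF i, of m]])
          (use 1 in \<open>cases m; simp add: field_simps power2_eq_square\<close>)
      from DERIV_mult[OF this DERIV_chain2[OF DERIV_exp DERIV_minus[OF i]]]
      show ?thesis
        using 1 by (simp add: flat_exp_def algebra_simps power2_eq_square)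
    qed
    moreover have "eventually (\<lambda>s. flat_exp m s = (1/s) ^ m * exp (- (1/s))) (nhds t)"
      using eventually_nhds_in_open[of "{0<..}" t] 1 by (auto simp: flat_exp_def elim!: eventually_mono)
    ultimately show ?thesis by (subst DERIV_cong_ev[OF refl _ refl]) auto
  next
    case 2
    have "eventually (\<lambda>s. flat_exp m s = 0) (nhds t)"
      using eventually_nhds_in_open[of "{..<0}" t] 2 by (auto simp: flat_exp_def elim!: eventually_mono)
    moreover have "((\<lambda>t. 0::real) has_real_derivative 0) (at t)" by simp
    ultimately show ?thesis using 2 by (subst DERIV_cong_ev[OF refl _ refl]) (auto simp: flat_exp_def)
  next
    case 3
    have "((\<lambda>y. (flat_exp m y - flat_exp m 0) / (y - 0)) \<longlongrightarrow> 0) (at 0)"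
    proof (rule Lim_null_comparison)
      show "\<forall>\<^sub>F y in at 0. norm ((flat_exp m y - flat_exp m 0) / (y - 0)) \<le> fact (m+2) * \<bar>y\<bar>"
      proof (rule eventually_at_filter[THEN iffD2], rule always_eventually, intro allI impI)
        fix y :: real assume "y \<noteq> 0"
        then show "norm ((flat_exp m y - flat_exp m 0) / (y - 0)) \<le> fact (m+2) * \<bar>y\<bar>"
          using flat_exp_le[of m y]
          by (simp add: flat_exp_def[of m 0] divide_le_eq power2_eq_square abs_mult_self_eq mult.assoc
              flip: abs_mult)
      qed
      show "((\<lambda>y. fact (m+2) * \<bar>y\<bar>) \<longlongrightarrow> 0) (at (0::real))"
        by (intro tendsto_eq_intros) auto
    qed
    then show ?thesis
      using 3 by (simp add: has_field_derivative_iff flat_exp_def[of _ 0])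
  qed
qed

lemma C_k_real_flat_exp: "C_k_real k (flat_exp m)"
proof (induction k arbitrary: m)
  case (Suc k)
  have "C_k_real k (\<lambda>t. flat_exp (m+2) t + - real m * flat_exp (m+1) t)"
    by (rule C_k_real_add[OF Suc.IH C_k_real_mult[OF C_k_real_const Suc.IH]])
  then show ?case by (rule C_k_real_SucI[OF flat_exp_deriv])
qed simp

text \<open>For a < b the product (t - a) (b - t) is positive exactly inside the interval. The
  factor k pushes the argument to infinity there, and the values to 1.\<close>

definition bump1 :: "nat \<Rightarrow> real \<Rightarrow> real \<Rightarrow> real \<Rightarrow> real" where
  "bump1 k a b t = flat_exp 0 (real k * ((t - a) * (b - t)))"

lemma C_k_real_bump1: "C_k_real m (bump1 k a b)"
proof -
  have "C_k_real m (\<lambda>t. real k * ((1 * t + - a) * (-1 * t + b)))"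
    by (rule C_k_real_mult[OF C_k_real_const C_k_real_mult[OF C_k_real_affine C_k_real_affine]])
  from C_k_real_compose[OF C_k_real_flat_exp[of m 0] this] show ?thesis
    by (simp add: bump1_def [abs_def])
qed

lemma bump1_bounds: "0 \<le> bump1 k a b t" "bump1 k a b t \<le> 1"
  by (auto simp: bump1_def flat_exp_def)

text \<open>A positive product with t outside the interval would need both factors negative, that is
  b < t < a, which a < b excludes.\<close>

lemma bump1_zero: "a < b \<Longrightarrow> t \<notin> {a<..<b} \<Longrightarrow> bump1 k a b t = 0"
  by (auto simp: bump1_def flat_exp_def zero_less_mult_iff)

lemma bump1_tendsto:
  assumes "a < t" "t < b"
  shows "(\<lambda>k. bump1 k a b t) \<longlonglongrightarrow> 1"
proof -
  define c where "c = (t - a) * (b - t)"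
  have c: "c > 0" using assms by (simp add: c_def)
  have "(\<lambda>k. exp (- ((1 / c) * (1 / real k)))) \<longlonglongrightarrow> exp (- ((1/c) * 0))"
    by (intro tendsto_intros lim_1_over_n)
  moreover have "\<forall>\<^sub>F k in sequentially. exp (- ((1 / c) * (1 / real k))) = bump1 k a b t"
    using eventually_gt_at_top[of 0]
    unfolding bump1_def c_def[symmetric]
    by eventually_elim (use c in \<open>simp add: flat_exp_def mult.commute\<close>)
  ultimately show ?thesis by (simp add: Lim_transform_eventually)
qed

section \<open>Products of one-variable functions as test functions on the plane\<close>

lemma has_derivative_product2:
  fixes x :: "real^2"
  assumes "(u has_real_derivative u') (at (x$1))" "(v has_real_derivative v') (at (x$2))"
  shows "((\<lambda>x. u (x$1) * v (x$2)) has_derivative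
     (\<lambda>h. u' * h$1 * v (x$2) + u (x$1) * (v' * h$2))) (at x)"
proof -
  have nth: "((\<lambda>x. x$i) has_derivative (\<lambda>h. h$i)) (at x)" for i
    by (rule bounded_linear_imp_has_derivative[OF bounded_linear_vec_nth])
  have 1: "((\<lambda>x. u (x$1)) has_derivative (\<lambda>h. u' * h$1)) (at x)"
    using has_derivative_compose[OF nth, of u "(*) u'"] assms(1)
    by (simp add: has_field_derivative_def)
  have 2: "((\<lambda>x. v (x$2)) has_derivative (\<lambda>h. v' * h$2)) (at x)"
    using has_derivative_compose[OF nth, of v "(*) v'"] assms(2)
    by (simp add: has_field_derivative_def)
  show ?thesis
    using has_derivative_mult[OF 1 2] by (simp add: algebra_simps)
qed

lemma axis_1_nth2 [simp]: "(axis 1 1 :: real^2) $ 2 = 0" "(axis 2 1 :: real^2) $ 1 = 0"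
  "(axis 1 1 :: real^2) $ 1 = 1" "(axis 2 1 :: real^2) $ 2 = 1"
  by (simp_all add: axis_def)

lemma frechet_derivative_product2:
  fixes x :: "real^2"
  assumes "\<And>t. (u has_real_derivative u' t) (at t)" "\<And>t. (v has_real_derivative v' t) (at t)"
  shows "frechet_derivative (\<lambda>x. u (x$1) * v (x$2)) (at x) (axis 1 1) = u' (x$1) * v (x$2)"
    "frechet_derivative (\<lambda>x. u (x$1) * v (x$2)) (at x) (axis 2 1) = u (x$1) * v' (x$2)"
  using frechet_derivative_at[OF has_derivative_product2[OF assms], symmetric] by simp_all

text \<open>\<open>C_k_real\<close> counts derivatives and asks nothing at level 0, whereas
  \<open>C_k\<close> ends with continuity. One more derivative of each factor supplies that
  continuity; hence the shift by one.\<close>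

lemma C_k_product2:
  "C_k_real (Suc k) u \<Longrightarrow> C_k_real (Suc k) v \<Longrightarrow> C_k k (\<lambda>x. u (x$1) * v (x$2))"
proof (induction k arbitrary: u v)
  case 0
  then have "continuous_on UNIV u" "continuous_on UNIV v"
    by (metis C_k_real_SucE DERIV_isCont continuous_at_imp_continuous_on)+
  then show ?case
    by (auto intro!: continuous_intros intro: continuous_on_compose2[of UNIV])
next
  case (Suc k)
  then obtain u' v' where *: "\<And>t. (u has_real_derivative u' t) (at t)" "C_k_real (Suc k) u'"
    "\<And>t. (v has_real_derivative v' t) (at t)" "C_k_real (Suc k) v'"
    by (metis C_k_real_SucE)
  have "C_k_real (Suc k) u" "C_k_real (Suc k) v" using Suc.prems C_k_real_SucD by blast+
  then show ?case
    using has_derivative_product2[OF *(1,3)] Suc.IH *(2,4)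
    by (auto simp: forall_2 frechet_derivative_product2[OF *(1,3)] differentiable_def)
qed

definition bump2 :: "nat \<Rightarrow> real^2 \<Rightarrow> real^2 \<Rightarrow> real^2 \<Rightarrow> real" where
  "bump2 k a b x = bump1 k (a$1) (b$1) (x$1) * bump1 k (a$2) (b$2) (x$2)"

lemma bump2_outside:
  assumes "a$1 < b$1" "a$2 < b$2" "x \<notin> box a b"
  shows "bump2 k a b x = 0"
  using assms bump1_zero by (fastforce simp: bump2_def mem_box_cart forall_2)

lemma test_function_bump2:
  assumes "a$1 < b$1" "a$2 < b$2" "cbox a b \<subseteq> B"
  shows "test_function B (bump2 k a b)"
proof -
  have "{x. bump2 k a b x \<noteq> 0} \<subseteq> cbox a b"
    using bump2_outside[OF assms(1,2)] box_subset_cbox by blast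
  then have "closure {x. bump2 k a b x \<noteq> 0} \<subseteq> cbox a b"
    by (rule closure_minimal[OF _ closed_cbox])
  moreover from this have "compact (closure {x. bump2 k a b x \<noteq> 0})"
    using bounded_cbox bounded_subset compact_eq_bounded_closed closed_closure by blast
  moreover have "C_k m (bump2 k a b)" for m
    unfolding bump2_def[abs_def] by (rule C_k_product2[OF C_k_real_bump1 C_k_real_bump1])
  ultimately show ?thesis
    using assms(3) unfolding test_function_def by blast
qed

lemma bump2_bounds: "0 \<le> bump2 k a b x" "bump2 k a b x \<le> 1"
  unfolding bump2_def by (auto intro: mult_nonneg_nonneg mult_le_one simp: bump1_bounds)

lemma bump2_tendsto:
  assumes "a$1 < b$1" "a$2 < b$2"
  shows "(\<lambda>k. bump2 k a b x) \<longlonglongrightarrow> indicator (box a b) x"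
proof (cases "x \<in> box a b")
  case True
  then show ?thesis
    using tendsto_mult[OF bump1_tendsto[of "a$1" "x$1" "b$1"] bump1_tendsto[of "a$2" "x$2" "b$2"]]
    by (simp add: bump2_def[abs_def] mem_box_cart forall_2)
qed (simp add: bump2_outside[OF assms])

lemma frechet_derivative_zero_outside_support:
  fixes \<phi> :: "real^2 \<Rightarrow> real"
  assumes "x \<notin> closure {x. \<phi> x \<noteq> 0}"
  shows "frechet_derivative \<phi> (at x) = (\<lambda>_. 0)"
proof -
  have "(\<phi> has_derivative (\<lambda>_. 0)) (at x)"
    by (rule has_derivative_transform_within_open[of "\<lambda>_. 0" _ _ _ "- closure {x. \<phi> x \<noteq> 0}"])
      (use assms closure_subset[of "{x. \<phi> x \<noteq> 0}"] in auto)
  then show ?thesis by (metis frechet_derivative_at)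
qed

text \<open>Needed to test a weak derivative against a derivative of a bump. The closed support
  cannot grow, since the function vanishes near every point outside it.\<close>

lemma test_function_partial:
  assumes "test_function B \<phi>"
  shows "test_function B (\<lambda>x. frechet_derivative \<phi> (at x) (axis j 1))" (is "test_function B ?\<psi>")
proof -
  have "{x. ?\<psi> x \<noteq> 0} \<subseteq> closure {x. \<phi> x \<noteq> 0}"
    using frechet_derivative_zero_outside_support by fastforce
  then have *: "closure {x. ?\<psi> x \<noteq> 0} \<subseteq> closure {x. \<phi> x \<noteq> 0}"
    by (rule closure_minimal[OF _ closed_closure])
  then have "compact (closure {x. ?\<psi> x \<noteq> 0})"
    using assms compact_Int_closed[of "closure {x. \<phi> x \<noteq> 0}" "closure {x. ?\<psi> x \<noteq> 0}"]
    by (simp add: test_function_def Int_absorb1)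
  moreover have "C_k k ?\<psi>" for k
    using assms C_k.simps(2)[of k \<phi>] unfolding test_function_def by blast
  ultimately show ?thesis
    using assms * unfolding test_function_def by blast
qed

lemma frechet_derivative_bump2_commute:
  "frechet_derivative (\<lambda>x. frechet_derivative (bump2 k a b) (at x) (axis i 1)) (at x) (axis j 1) =
   frechet_derivative (\<lambda>x. frechet_derivative (bump2 k a b) (at x) (axis j 1)) (at x) (axis i 1)"
proof -
  define u v where "u = bump1 k (a$1) (b$1)" and "v = bump1 k (a$2) (b$2)"
  obtain u' v' u'' v'' where *: "\<And>t. (u has_real_derivative u' t) (at t)" "\<And>t. (u' has_real_derivative u'' t) (at t)"
    "\<And>t. (v has_real_derivative v' t) (at t)"  "\<And>t. (v' has_real_derivative v'' t) (at t)"
    using C_k_real_bump1[of "Suc (Suc 0)"] unfolding u_def v_def by (metis C_k_real_SucE)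
  have "bump2 k a b = (\<lambda>x. u (x$1) * v (x$2))"
    by (simp add: fun_eq_iff bump2_def u_def v_def)
  then show ?thesis
    using exhaust_2[of i] exhaust_2[of j]
    by (auto simp: frechet_derivative_product2[OF *(1,3)] frechet_derivative_product2[OF *(1,4)] frechet_derivative_product2[OF *(2,3)])
qed

subsection \<open>Uniqueness of weak partial derivatives\<close>

lemma integrable_lebesgue_cong_AE:
  fixes f g :: "'a::euclidean_space \<Rightarrow> 'b::euclidean_space"
  assumes "integrable lebesgue f" "AE x in lebesgue. f x = g x"
  shows "integrable lebesgue g"
proof -
  have "g \<in> borel_measurable lebesgue"
    by (rule borel_measurable_AE[OF borel_measurable_integrable[OF assms(1)] assms(2)])
  then show ?thesis by (rule integrable_cong_AE_imp[OF assms(1) _ assms(2)])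
qed

text \<open>Completeness of Lebesgue measure carries measurability and integrability from one
  function to the other. If either is not integrable, neither is, and both integrals have the
  default value 0.\<close>

lemma integral_lebesgue_cong_AE:
  fixes f g :: "'a::euclidean_space \<Rightarrow> 'b::euclidean_space"
  assumes "AE x in lebesgue. f x = g x"
  shows "integral\<^sup>L lebesgue f = integral\<^sup>L lebesgue g"
proof (cases "integrable lebesgue f")
  case True
  then have "integrable lebesgue g" using assms by (rule integrable_lebesgue_cong_AE)
  then show ?thesis using True assms by (intro integral_cong_AE) auto
next
  case False
  have "AE x in lebesgue. g x = f x" using assms by (rule AE_symmetric)
  then have "\<not> integrable lebesgue g" using False integrable_lebesgue_cong_AE[of g f] by auto
  then show ?thesis using False by (simp add: not_integrable_integral_eq)
qed

lemma bump2_measurable: "bump2 k a b \<in> borel_measurable lebesgue"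
proof -
  have "continuous_on UNIV (bump2 k a b)"
    using C_k_product2[OF C_k_real_bump1 C_k_real_bump1, of 0 k "a$1" "b$1" k "a$2" "b$2"]
    unfolding bump2_def[abs_def] by simp
  then have "bump2 k a b \<in> borel_measurable lborel"
    using borel_measurable_continuous_onI by simp
  then show ?thesis by (rule measurable_completion)
qed

context
  fixes B :: "(real^2) set" and g :: "real^2 \<Rightarrow> real" and a b :: "real^2"
  assumes g: "locally_integrable_on g B"
    and ab: "a$1 < b$1" "a$2 < b$2" "cbox a b \<subseteq> B"
begin

lemma integrable_on_cbox: "integrable lebesgue (\<lambda>x. indicator (cbox a b) x *\<^sub>R g x)"
  using g ab compact_cbox unfolding locally_integrable_on_def set_integrable_def by blast

text \<open>The bump vanishes off the box, so B can be traded for the compact box, where local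
  integrability makes g integrable.\<close>

lemma indicator_bump2:
  "indicator B x *\<^sub>R (g x * bump2 k a b x) = (indicator (cbox a b) x *\<^sub>R g x) * bump2 k a b x"
  using bump2_outside[OF ab(1,2), of x k] box_subset_cbox[of a b] ab(3)
  by (cases "x \<in> box a b") (auto simp: indicator_def)

lemma measurable_times_bump2:
  "(\<lambda>x. (indicator (cbox a b) x *\<^sub>R g x) * bump2 k a b x) \<in> borel_measurable lebesgue"
  by (intro borel_measurable_times bump2_measurable borel_measurable_integrable integrable_on_cbox)

lemma norm_times_bump2:
  "norm ((indicator (cbox a b) x *\<^sub>R g x) * bump2 k a b x) \<le> norm (indicator (cbox a b) x *\<^sub>R g x)"
  using bump2_bounds[of k a b x] by (simp add: abs_mult mult_left_le)

lemma set_integrable_bump2: "set_integrable lebesgue B (\<lambda>x. g x * bump2 k a b x)"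
  unfolding set_integrable_def indicator_bump2
  by (rule Bochner_Integration.integrable_bound[OF integrable_on_cbox measurable_times_bump2])
    (simp only: norm_times_bump2 eventually_True AE_I2)

lemma bump2_integral_tendsto:
  "(\<lambda>k. LINT x:B|lebesgue. g x * bump2 k a b x) \<longlonglongrightarrow> (LINT x:box a b|lebesgue. g x)"
  unfolding set_lebesgue_integral_def indicator_bump2
proof (rule integral_dominated_convergence[OF _ measurable_times_bump2 integrable_norm[OF integrable_on_cbox]])
  have "set_integrable lebesgue (box a b) g"
    by (rule set_integrable_subset[of _ "cbox a b"])
      (use integrable_on_cbox box_subset_cbox[of a b] in \<open>simp_all add: set_integrable_def\<close>)
  then show "(\<lambda>x. indicator (box a b) x *\<^sub>R g x) \<in> borel_measurable lebesgue"
    unfolding set_integrable_def by (rule borel_measurable_integrable)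
  show "AE x in lebesgue. (\<lambda>k. indicator (cbox a b) x *\<^sub>R g x * bump2 k a b x) \<longlonglongrightarrow> indicator (box a b) x *\<^sub>R g x"
  proof (rule AE_I2)
    fix x
    have "(\<lambda>k. indicator (cbox a b) x *\<^sub>R g x * bump2 k a b x)
       \<longlonglongrightarrow> indicator (cbox a b) x *\<^sub>R g x * indicator (box a b) x"
      by (intro tendsto_intros bump2_tendsto ab)
    then show "(\<lambda>k. indicator (cbox a b) x *\<^sub>R g x * bump2 k a b x) \<longlonglongrightarrow> indicator (box a b) x *\<^sub>R g x"
      using box_subset_cbox[of a b] by (auto simp: indicator_def split: if_splits)
  qed
qed (use norm_times_bump2 in auto)

end

text \<open>Letting k grow turns the hypothesis into vanishing integrals of g over all boxes with
  closure in B. Lebesgue's differentiation theorem gives g = 0 almost everywhere on each such box,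
  and countably many boxes exhaust B.\<close>

lemma AE_zero_if_bump2_integrals_zero:
  fixes g :: "real^2 \<Rightarrow> real"
  assumes "open B" and g: "locally_integrable_on g B"
    and 0: "\<And>a b k. a$1 < b$1 \<Longrightarrow> a$2 < b$2 \<Longrightarrow> cbox a b \<subseteq> B \<Longrightarrow>
      (LINT x:B|lebesgue. g x * bump2 k a b x) = 0"
  shows "AE x in lebesgue. x \<in> B \<longrightarrow> g x = 0"
proof -
  have int0: "(LINT x:box a b|lebesgue. g x) = 0" if "cbox a b \<subseteq> B" for a b
  proof (cases "a$1 < b$1 \<and> a$2 < b$2")
    case True
    show ?thesis
      using bump2_integral_tendsto[OF g _ _ that] 0[OF _ _ that] True
      by (simp add: LIMSEQ_const_iff)
  next
    case False
    then have "box a b = {}" using not_less unfolding interval_eq_empty_cart by blast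
    then show ?thesis by (simp add: set_lebesgue_integral_def)
  qed
  have box: "AE x in lebesgue. x \<in> box a b \<longrightarrow> g x = 0" if ab: "cbox a b \<subseteq> B" for a b
  proof -
    \<comment> \<open>Cutting g off outside one box gives a function integrable on the whole plane,
      as the differentiation theorem demands. Its integral over another box is that of g over the
      intersection, again a box.\<close>
    define f where "f = (\<lambda>x. if x \<in> box a b then g x else 0)"
    have "set_integrable lebesgue (cbox a b) g"
      using g ab compact_cbox unfolding locally_integrable_on_def by blast
    then have "set_integrable lebesgue (box a b) g"
      by (rule set_integrable_subset) (auto simp: box_subset_cbox)
    then have f: "integrable lebesgue f"
      unfolding set_integrable_def f_def
      by (rule Bochner_Integration.integrable_cong[OF refl, THEN iffD1, rotated]) simp
    have fS: "set_integrable lebesgue S f" if "S \<in> sets lebesgue" for S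
      using f that unfolding set_integrable_def by (rule integrable_mult_indicator[rotated])
    have I: "integral (cbox c d) f = 0" for c d
    proof -
      define p q :: "real^2" where "p = (\<chi> i. max (a$i) (c$i))" and "q = (\<chi> i. min (b$i) (d$i))"
      have pq: "box c d \<inter> box a b = box p q" "cbox p q \<subseteq> cbox a b"
        by (auto simp: p_def q_def mem_box_cart)
      have "integral (cbox c d) f = integral (box c d) f"
        by (simp add: integral_open_interval)
      also have "\<dots> = (LINT x:box c d|lebesgue. f x)"
        by (rule set_lebesgue_integral_eq_integral(2)[symmetric]) (simp add: fS)
      also have "\<dots> = (LINT x:box p q|lebesgue. g x)"
        unfolding set_lebesgue_integral_def pq(1)[symmetric]
        by (rule Bochner_Integration.integral_cong) (auto simp: f_def indicator_def)
      also have "\<dots> = 0" using int0 pq ab by blast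
      finally show ?thesis .
    qed
    have "f integrable_on cbox c d" for c d
      using set_lebesgue_integral_eq_integral(1)[OF fS] by simp
    \<comment> \<open>Lebesgue differentiation along cubes with corner x. All averages are 0 by
      \<open>I\<close>, so the choice e = |f x| > 0 would leave no h between 0 and
      \<open>h'\<close>.\<close>
    then obtain N where N: "negligible N" "\<And>x e. \<lbrakk>x \<notin> N; 0 < e\<rbrakk> \<Longrightarrow>
       \<exists>h'>0. \<forall>h. 0 < h \<and> h < h' \<longrightarrow> norm (integral (cbox x (x + h *\<^sub>R One)) f /\<^sub>R h ^ DIM(real^2) - f x) < e"
      by (rule integrable_ccontinuous_explicit) blast
    have "f x = 0" if xN: "x \<notin> N" for x
    proof (rule ccontr)
      assume "f x \<noteq> 0"
      then have "\<exists>h'>0. \<forall>h. \<not> (0 < h \<and> h < (h'::real))"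
        using N(2)[OF xN, of "norm (f x)"] by (simp add: I)
      then show False using dense by blast
    qed
    then have "AE x in lebesgue. f x = 0"
      using N(1) eventually_ae_filter_negligible by blast
    then show ?thesis by eventually_elim (auto simp: f_def split: if_splits)
  qed
  obtain D where D: "countable D" "D \<subseteq> Pow B" "\<And>X. X \<in> D \<Longrightarrow> \<exists>a b. X = cbox a b" "\<Union>D = B"
    using open_countable_Union_open_cbox[OF \<open>open B\<close>] by metis
  have "AE x in lebesgue. x \<in> X \<longrightarrow> g x = 0" if XD: "X \<in> D" for X
  proof -
    obtain a b where X: "X = cbox a b" using D(3)[OF XD] by blast
    \<comment> \<open>The covering of B consists of closed boxes, while \<open>box\<close> speaks of
      open ones; they differ by a null set.\<close>
    have "AE x in lebesgue. x \<notin> cbox a b - box a b"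
      by (rule AE_not_in) (simp add: negligible_frontier_interval flip: negligible_iff_null_sets)
    moreover have "AE x in lebesgue. x \<in> box a b \<longrightarrow> g x = 0"
      using box D(2) XD X by blast
    ultimately show ?thesis by eventually_elim (auto simp: X)
  qed
  then have "AE x in lebesgue. \<forall>X\<in>D. x \<in> X \<longrightarrow> g x = 0"
    unfolding AE_ball_countable[OF D(1)] by blast
  then show ?thesis by eventually_elim (use D(4) in blast)
qed

lemma locally_integrable_on_diff:
  "locally_integrable_on f B \<Longrightarrow> locally_integrable_on g B \<Longrightarrow> locally_integrable_on (\<lambda>x. f x - g x) B"
  unfolding locally_integrable_on_def by (simp add: set_integral_diff)

lemma AE_eq_if_bump2_integrals_eq:
  assumes "open B" and fg: "locally_integrable_on f B" "locally_integrable_on g B"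
    and eq: "\<And>a b k. a$1 < b$1 \<Longrightarrow> a$2 < b$2 \<Longrightarrow> cbox a b \<subseteq> B \<Longrightarrow>
      (LINT x:B|lebesgue. f x * bump2 k a b x) = (LINT x:B|lebesgue. g x * bump2 k a b x)"
  shows "AE x in lebesgue. x \<in> B \<longrightarrow> f x = g x"
proof -
  have "AE x in lebesgue. x \<in> B \<longrightarrow> f x - g x = 0"
  proof (rule AE_zero_if_bump2_integrals_zero[OF \<open>open B\<close> locally_integrable_on_diff[OF fg]])
    fix a b :: "real^2" and k assume *: "a$1 < b$1" "a$2 < b$2" "cbox a b \<subseteq> B"
    show "(LINT x:B|lebesgue. (f x - g x) * bump2 k a b x) = 0"
      using set_integral_diff(2)[OF set_integrable_bump2[OF fg(1) *] set_integrable_bump2[OF fg(2) *]] eq[OF *]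
      by (simp add: left_diff_distrib)
  qed
  then show ?thesis by simp
qed

lemma has_weak_partialD:
  assumes "has_weak_partial B f j g" "test_function B \<phi>"
  shows "(LINT x:B|lebesgue. f x * frechet_derivative \<phi> (at x) (axis j 1)) = - (LINT x:B|lebesgue. g x * \<phi> x)"
  using assms unfolding has_weak_partial_def by simp

lemma weak_partial_unique:
  assumes "open B" "has_weak_partial B f j g" "has_weak_partial B f j g'"
  shows "AE x in lebesgue. x \<in> B \<longrightarrow> g x = g' x"
proof (rule AE_eq_if_bump2_integrals_eq[OF \<open>open B\<close>])
  fix a b :: "real^2" and k assume *: "a$1 < b$1" "a$2 < b$2" "cbox a b \<subseteq> B"
  have "test_function B (bump2 k a b)" by (rule test_function_bump2[OF *])
  from has_weak_partialD[OF assms(2) this] has_weak_partialD[OF assms(3) this]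
  show "(LINT x:B|lebesgue. g x * bump2 k a b x) = (LINT x:B|lebesgue. g' x * bump2 k a b x)"
    by linarith
qed (use assms in \<open>auto simp: has_weak_partial_def\<close>)

text \<open>Both derivatives are moved onto the bump, interchanged there and moved back. The middle
  steps test \<open>f\<close> against a second derivative of the bump.\<close>

lemma weak_partials_commute:
  assumes "open B" "has_weak_partial B f i g1" "has_weak_partial B f j g2"
    and "has_weak_partial B g1 j h1" "has_weak_partial B g2 i h2"
  shows "AE x in lebesgue. x \<in> B \<longrightarrow> h1 x = h2 x"
proof (rule AE_eq_if_bump2_integrals_eq[OF \<open>open B\<close>])
  fix a b :: "real^2" and k assume *: "a$1 < b$1" "a$2 < b$2" "cbox a b \<subseteq> B"
  let ?d = "\<lambda>\<phi> i x. frechet_derivative \<phi> (at x) (axis i (1::real))"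
  have t: "test_function B (bump2 k a b)" by (rule test_function_bump2[OF *])
  have "(LINT x:B|lebesgue. h1 x * bump2 k a b x) = - (LINT x:B|lebesgue. g1 x * ?d (bump2 k a b) j x)"
    using has_weak_partialD[OF assms(4) t] by linarith
  also have "\<dots> = (LINT x:B|lebesgue. f x * ?d (?d (bump2 k a b) j) i x)"
    using has_weak_partialD[OF assms(2) test_function_partial[OF t, of j]] by linarith
  also have "\<dots> = (LINT x:B|lebesgue. f x * ?d (?d (bump2 k a b) i) j x)"
    by (subst frechet_derivative_bump2_commute) simp
  also have "\<dots> = - (LINT x:B|lebesgue. g2 x * ?d (bump2 k a b) i x)"
    using has_weak_partialD[OF assms(3) test_function_partial[OF t, of i]] by linarith
  also have "\<dots> = (LINT x:B|lebesgue. h2 x * bump2 k a b x)"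
    using has_weak_partialD[OF assms(5) t] by linarith
  finally show "(LINT x:B|lebesgue. h1 x * bump2 k a b x) = (LINT x:B|lebesgue. h2 x * bump2 k a b x)" .
qed (use assms in \<open>auto simp: has_weak_partial_def\<close>)

section \<open>Independence of the chosen representatives\<close>

lemma locally_integrable_on_cong_AE:
  assumes "locally_integrable_on f B" "AE x in lebesgue. x \<in> B \<longrightarrow> f x = f' x"
  shows "locally_integrable_on f' B"
  unfolding locally_integrable_on_def
proof (intro allI impI)
  fix K assume K: "compact K \<and> K \<subseteq> B"
  have "AE x in lebesgue. indicator K x *\<^sub>R f x = indicator K x *\<^sub>R f' x"
    using assms(2) by eventually_elim (use K in \<open>auto simp: indicator_def\<close>)
  then show "set_integrable lebesgue K f'"
    using assms(1) K unfolding locally_integrable_on_def set_integrable_def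
    by (blast intro: integrable_lebesgue_cong_AE)
qed

lemma set_integral_lebesgue_cong_AE:
  fixes f g :: "real^2 \<Rightarrow> real"
  assumes "AE x in lebesgue. x \<in> B \<longrightarrow> f x = g x"
  shows "(LINT x:B|lebesgue. f x) = (LINT x:B|lebesgue. g x)"
proof -
  have "AE x in lebesgue. indicator B x *\<^sub>R f x = indicator B x *\<^sub>R g x"
    using assms by eventually_elim (auto simp: indicator_def)
  then show ?thesis unfolding set_lebesgue_integral_def by (rule integral_lebesgue_cong_AE)
qed

lemma has_weak_partial_cong_AE:
  assumes "has_weak_partial B f j g" "AE x in lebesgue. x \<in> B \<longrightarrow> f x = f' x"
    "AE x in lebesgue. x \<in> B \<longrightarrow> g x = g' x"
  shows "has_weak_partial B f' j g'"
  unfolding has_weak_partial_def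
proof (intro conjI allI impI)
  show "locally_integrable_on f' B" "locally_integrable_on g' B"
    using assms locally_integrable_on_cong_AE unfolding has_weak_partial_def by blast+
  fix \<phi> assume "test_function B \<phi>"
  then have "(LINT x:B|lebesgue. f x * frechet_derivative \<phi> (at x) (axis j 1)) =
        - (LINT x:B|lebesgue. g x * \<phi> x)"
    by (rule has_weak_partialD[OF assms(1)])
  moreover have "(LINT x:B|lebesgue. f x * frechet_derivative \<phi> (at x) (axis j 1)) =
      (LINT x:B|lebesgue. f' x * frechet_derivative \<phi> (at x) (axis j 1))"
    by (rule set_integral_lebesgue_cong_AE) (use assms(2) in \<open>eventually_elim, simp\<close>)
  moreover have "(LINT x:B|lebesgue. g x * \<phi> x) = (LINT x:B|lebesgue. g' x * \<phi> x)"
    by (rule set_integral_lebesgue_cong_AE) (use assms(3) in \<open>eventually_elim, simp\<close>)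
  ultimately show "(LINT x:B|lebesgue. f' x * frechet_derivative \<phi> (at x) (axis j 1)) =
      - (LINT x:B|lebesgue. g' x * \<phi> x)" by simp
qed

lemma weak_partial_works: "has_weak_partial B f j g \<Longrightarrow> has_weak_partial B f j (weak_partial B j f)"
  unfolding weak_partial_def by (rule someI[of "has_weak_partial B f j"])

lemma weak_partial_AE_eq:
  "open B \<Longrightarrow> has_weak_partial B f j g \<Longrightarrow> AE x in lebesgue. x \<in> B \<longrightarrow> weak_partial B j f x = g x"
  by (rule weak_partial_unique[OF _ weak_partial_works])

text \<open>The inner \<open>weak_partial\<close> is some selected representative and not the given
  \<open>g\<close>. Since having a weak derivative is invariant under changes on null sets, the
  derivative \<open>h\<close> of \<open>g\<close> serves for it as well.\<close>

lemma weak_partial_weak_partial: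
  assumes "open B" "has_weak_partial B f i g" "has_weak_partial B g j h"
  shows "has_weak_partial B (weak_partial B i f) j (weak_partial B j (weak_partial B i f))"
    and "AE x in lebesgue. x \<in> B \<longrightarrow> weak_partial B j (weak_partial B i f) x = h x"
proof -
  have "AE x in lebesgue. x \<in> B \<longrightarrow> g x = weak_partial B i f x"
    using weak_partial_AE_eq[OF assms(1,2)] by eventually_elim simp
  from has_weak_partial_cong_AE[OF assms(3) this]
  have *: "has_weak_partial B (weak_partial B i f) j h" by simp
  show "has_weak_partial B (weak_partial B i f) j (weak_partial B j (weak_partial B i f))"
    by (rule weak_partial_works[OF *])
  show "AE x in lebesgue. x \<in> B \<longrightarrow> weak_partial B j (weak_partial B i f) x = h x"
    by (rule weak_partial_AE_eq[OF assms(1) *])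
qed

subsection \<open>Weak partial derivatives of locally Lipschitz functions\<close>

text \<open>The ball is one of the whole plane and may leave S. The condition is thus one at each
  point separately, which allows gluing arguments to treat the singletons {x} one by one.\<close>

definition locally_lipschitz_on :: "(real^2) set \<Rightarrow> (real^2 \<Rightarrow> real) \<Rightarrow> bool" where
  "locally_lipschitz_on S f \<longleftrightarrow> (\<forall>x\<in>S. \<exists>e>0. \<exists>L. L-lipschitz_on (ball x e) f)"

lemma locally_lipschitz_onE:
  assumes "locally_lipschitz_on S f" "x \<in> S"
  obtains e L where "e > 0" "L-lipschitz_on (ball x e) f"
  using assms unfolding locally_lipschitz_on_def by blast

lemma locally_lipschitz_on_subset:
  "locally_lipschitz_on S f \<Longrightarrow> T \<subseteq> S \<Longrightarrow> locally_lipschitz_on T f"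
  unfolding locally_lipschitz_on_def by blast

lemma locally_lipschitz_on_continuous:
  assumes "locally_lipschitz_on S f" "x \<in> S"
  shows "isCont f x"
proof -
  obtain e L where e: "e > 0" "L-lipschitz_on (ball x e) f"
    using assms by (rule locally_lipschitz_onE)
  have "continuous (at x within ball x e) f"
    by (rule lipschitz_on_continuous_within[OF e(2)]) (simp add: e(1))
  then show ?thesis using at_within_open[of x "ball x e"] e(1) by simp
qed

lemma locally_lipschitz_on_transform:
  assumes "x \<in> S" "open S" "\<And>y. y \<in> S \<Longrightarrow> f y = g y" "locally_lipschitz_on {x} f"
  shows "locally_lipschitz_on {x} g"
proof -
  obtain e L where e: "e > 0" "L-lipschitz_on (ball x e) f"
    using assms(4) by (rule locally_lipschitz_onE) simp
  obtain d where d: "d > 0" "ball x d \<subseteq> S" using assms(1,2) open_contains_ball by blast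
  have "L-lipschitz_on (ball x (min d e)) f"
    by (rule lipschitz_on_subset[OF e(2)]) auto
  then have "L-lipschitz_on (ball x (min d e)) g"
    by (rule lipschitz_on_transform) (use d assms(3) in auto)
  then show ?thesis using e(1) d(1) unfolding locally_lipschitz_on_def
    by (intro ballI exI[of _ "min d e"]) auto
qed

lemma locally_lipschitz_on_pointwise: "locally_lipschitz_on S f \<longleftrightarrow> (\<forall>x\<in>S. locally_lipschitz_on {x} f)"
  unfolding locally_lipschitz_on_def by blast

lemma lipschitz_on_ball_bounded:
  fixes f :: "real^2 \<Rightarrow> real"
  assumes "L-lipschitz_on (ball x e) f" "y \<in> ball x e"
  shows "\<bar>f y\<bar> \<le> \<bar>f x\<bar> + L * e"
proof -
  have "e > 0" using assms(2) by (simp add: dist_commute order_le_less_trans[OF zero_le_dist])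
  then have "\<bar>f y - f x\<bar> \<le> L * dist y x"
    using lipschitz_onD[OF assms(1,2), of x] by (simp add: dist_real_def)
  also have "\<dots> \<le> L * e"
    using assms lipschitz_on_nonneg[OF assms(1)] by (intro mult_left_mono) (auto simp: dist_commute)
  finally show ?thesis by linarith
qed

lemma locally_lipschitz_on_mult:
  assumes "locally_lipschitz_on S f" "locally_lipschitz_on S g"
  shows "locally_lipschitz_on S (\<lambda>x. f x * g x)"
  unfolding locally_lipschitz_on_def
proof
  fix x assume x: "x \<in> S"
  obtain d K where K: "d > 0" "K-lipschitz_on (ball x d) f"
    using assms(1) x by (rule locally_lipschitz_onE)
  obtain e L where L: "e > 0" "L-lipschitz_on (ball x e) g"
    using assms(2) x by (rule locally_lipschitz_onE)
  define r where "r = min d e"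
  have K': "K-lipschitz_on (ball x r) f" and L': "L-lipschitz_on (ball x r) g"
    by (rule lipschitz_on_subset[OF K(2)] lipschitz_on_subset[OF L(2)]; auto simp: r_def)+
  define A where "A = \<bar>f x\<bar> + K * r"
  define B where "B = \<bar>g x\<bar> + L * r"
  have "r > 0" using K L by (simp add: r_def)
  have KL: "K \<ge> 0" "L \<ge> 0" using K' L' lipschitz_on_nonneg by auto
  then have AB: "A \<ge> 0" "B \<ge> 0" using \<open>r > 0\<close> by (auto simp: A_def B_def)
  have "(A * L + K * B)-lipschitz_on (ball x r) (\<lambda>x. f x * g x)"
  proof (rule lipschitz_onI)
    fix y z assume y: "y \<in> ball x r" and z: "z \<in> ball x r"
    have "\<bar>f y * g y - f z * g z\<bar> \<le> \<bar>f y\<bar> * \<bar>g y - g z\<bar> + \<bar>f y - f z\<bar> * \<bar>g z\<bar>"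
    proof -
      have "f y * g y - f z * g z = f y * (g y - g z) + (f y - f z) * g z"
        by (simp add: algebra_simps)
      then show ?thesis
        using abs_triangle_ineq[of "f y * (g y - g z)" "(f y - f z) * g z"] by (simp add: abs_mult)
    qed
    also have "\<dots> \<le> A * (L * dist y z) + (K * dist y z) * B"
      using lipschitz_onD[OF K' y z] lipschitz_onD[OF L' y z] KL AB
        lipschitz_on_ball_bounded[OF K' y] lipschitz_on_ball_bounded[OF L' z]
      by (intro add_mono mult_mono) (auto simp: dist_real_def A_def B_def)
    finally show "dist (f y * g y) (f z * g z) \<le> (A * L + K * B) * dist y z"
      by (simp add: dist_real_def algebra_simps)
  qed (use KL AB in auto)
  then show "\<exists>e>0. \<exists>L. L-lipschitz_on (ball x e) (\<lambda>x. f x * g x)"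
    using \<open>r > 0\<close> by blast
qed

lemma locally_lipschitz_on_add:
  assumes "locally_lipschitz_on S f" "locally_lipschitz_on S g"
  shows "locally_lipschitz_on S (\<lambda>x. f x + g x)"
  unfolding locally_lipschitz_on_def
proof
  fix x assume x: "x \<in> S"
  obtain d K where K: "d > 0" "K-lipschitz_on (ball x d) f"
    using assms(1) x by (rule locally_lipschitz_onE)
  obtain e L where L: "e > 0" "L-lipschitz_on (ball x e) g"
    using assms(2) x by (rule locally_lipschitz_onE)
  have "(K + L)-lipschitz_on (ball x (min d e)) (\<lambda>x. f x + g x)"
    by (rule lipschitz_on_add; rule lipschitz_on_subset[OF K(2)] lipschitz_on_subset[OF L(2)]; auto)
  then show "\<exists>e>0. \<exists>L. L-lipschitz_on (ball x e) (\<lambda>x. f x + g x)"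
    using K(1) L(1) by (intro exI[of _ "min d e"]) auto
qed

lemma locally_lipschitz_on_const: "locally_lipschitz_on S (\<lambda>_. c)"
  unfolding locally_lipschitz_on_def using lipschitz_on_constant zero_less_one by blast

lemma locally_lipschitz_on_linear:
  assumes "bounded_linear f"
  shows "locally_lipschitz_on S f"
  unfolding locally_lipschitz_on_def
proof
  fix x
  obtain L where "L-lipschitz_on (ball x 1) f" using bounded_linear.lipschitz_boundE[OF assms] .
  then show "\<exists>e>0. \<exists>L. L-lipschitz_on (ball x e) f" using zero_less_one by blast
qed

lemma locally_lipschitz_on_abs:
  assumes "locally_lipschitz_on S f"
  shows "locally_lipschitz_on S (\<lambda>x. \<bar>f x\<bar>)"
  unfolding locally_lipschitz_on_def
proof
  fix x assume x: "x \<in> S"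
  obtain d K where K: "d > 0" "K-lipschitz_on (ball x d) f"
    using assms x by (rule locally_lipschitz_onE)
  have "K-lipschitz_on (ball x d) (\<lambda>x. \<bar>f x\<bar>)"
  proof (rule lipschitz_onI)
    fix y z assume "y \<in> ball x d" "z \<in> ball x d"
    then have "\<bar>f y - f z\<bar> \<le> K * dist y z" using lipschitz_onD[OF K(2)] by (simp add: dist_real_def)
    then show "dist \<bar>f y\<bar> \<bar>f z\<bar> \<le> K * dist y z"
      using abs_triangle_ineq3[of "f y" "f z"] by (simp add: dist_real_def)
  qed (rule lipschitz_on_nonneg[OF K(2)])
  then show "\<exists>e>0. \<exists>L. L-lipschitz_on (ball x e) (\<lambda>x. \<bar>f x\<bar>)" using K(1) by blast
qed

text \<open>A function is a constant family of maps over a one-point time set; for locally Lipschitz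
  families compactness yields a uniform constant.\<close>

lemma locally_lipschitz_on_compact:
  assumes "locally_lipschitz_on UNIV f" "compact K"
  obtains L where "L-lipschitz_on K f"
proof -
  have "local_lipschitz {0::real} K (\<lambda>_. f)"
  proof (rule local_lipschitzI)
    fix x assume "x \<in> K"
    obtain e L where e: "e > 0" "L-lipschitz_on (ball x e) f"
      using assms(1) UNIV_I by (rule locally_lipschitz_onE)
    have "L-lipschitz_on (cball x (e/2) \<inter> K) f"
      by (rule lipschitz_on_subset[OF e(2)]) (use e(1) in auto)
    then show "\<exists>u>0. \<exists>L. \<forall>t\<in>cball t u \<inter> {0::real}. L-lipschitz_on (cball x u \<inter> K) f" for t
      using e(1) by (intro exI[of _ "e/2"]) auto
  qed
  then show ?thesis
    using local_lipschitz_compact_implies_lipschitz[OF _ assms(2), of "{0::real}" "\<lambda>_. f"] that by auto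
qed

section \<open>Partial derivatives as limits of difference quotients\<close>

lemma difference_quotient_tendsto:
  fixes f :: "real^2 \<Rightarrow> real"
  assumes "(f has_derivative f') (at x)"
  shows "(\<lambda>k. (f (x + (1 / real (Suc k)) *\<^sub>R e) - f x) * real (Suc k)) \<longlonglongrightarrow> f' e"
proof -
  have 1: "((\<lambda>h::real. x + h *\<^sub>R e) has_derivative (\<lambda>h. h *\<^sub>R e)) (at 0)"
    by (auto intro!: derivative_eq_intros)
  have "((\<lambda>h. f (x + h *\<^sub>R e)) has_derivative (\<lambda>h. f' (h *\<^sub>R e))) (at 0)"
    using has_derivative_compose[OF 1, of f f'] assms by simp
  moreover have "f' (h *\<^sub>R e) = f' e * h" for h
    using linear_cmul[OF has_derivative_linear[OF assms], of h e] by simp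
  ultimately have "((\<lambda>h. f (x + h *\<^sub>R e)) has_real_derivative f' e) (at 0)"
    by (simp add: has_field_derivative_def fun_eq_iff)
  then have "((\<lambda>h. (f (x + h *\<^sub>R e) - f x) / h) \<longlongrightarrow> f' e) (at 0)"
    by (simp add: DERIV_def)
  moreover have "filterlim (\<lambda>k. 1 / real (Suc k)) (at 0) sequentially"
    by (rule filterlim_atI[OF LIMSEQ_Suc[OF lim_1_over_n]]) simp
  ultimately have "(\<lambda>k. (f (x + (1 / real (Suc k)) *\<^sub>R e) - f x) / (1 / real (Suc k))) \<longlonglongrightarrow> f' e"
    by (rule filterlim_compose)
  then show ?thesis by simp
qed

lemma integral_lebesgue_translation:
  fixes F :: "real^2 \<Rightarrow> real"
  assumes "F \<in> borel_measurable borel" "integrable lebesgue F"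
  shows "integrable lebesgue (\<lambda>x. F (x + c))" "(LINT x|lebesgue. F (x + c)) = (LINT x|lebesgue. F x)"
proof -
  have m: "(\<lambda>x. F (c + x)) \<in> borel_measurable borel"
    using assms(1) by measurable
  have F: "integrable lborel F" using assms by (simp add: integrable_completion)
  have "integrable (distr lborel borel ((+) c)) F" unfolding lborel_distr_plus by (rule F)
  then have "integrable lborel (\<lambda>x. F (c + x))"
    by (subst (asm) integrable_distr_eq) (use assms(1) in auto)
  then show "integrable lebesgue (\<lambda>x. F (x + c))"
    using m by (simp add: integrable_completion add.commute)
  have "integral\<^sup>L lborel F = integral\<^sup>L (distr lborel borel ((+) c)) F" by (simp add: lborel_distr_plus)
  also have "\<dots> = (LINT x|lborel. F (c + x))"
    by (rule integral_distr) (use assms(1) in auto)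
  finally show "(LINT x|lebesgue. F (x + c)) = (LINT x|lebesgue. F x)"
    using m assms(1) by (simp add: integral_completion add.commute)
qed

lemma continuous_integrable_lebesgue:
  fixes f :: "real^2 \<Rightarrow> real"
  assumes "compact K" "continuous_on K f"
  shows "set_integrable lebesgue K f"
  using borel_integrable_compact[OF assms]
  by (simp add: set_integrable_def integrable_completion borel_measurable_integrable)



text \<open>Each difference quotient has integral 0 by translation invariance, and a Lipschitz
  constant on a larger ball dominates all of them, so the limit passes under the integral.\<close>

lemma integral_partial_derivative_eq_0:
  fixes F :: "real^2 \<Rightarrow> real"
  assumes lip: "locally_lipschitz_on UNIV F" and supp: "\<And>x. x \<notin> cball 0 R \<Longrightarrow> F x = 0"
    and D: "AE x in lebesgue. (F has_derivative F' x) (at x)"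
  shows "(LINT x|lebesgue. F' x (axis j 1)) = 0"
proof -
  define e :: "real^2" where "e = axis j 1"
  have ne: "norm e = 1" by (simp add: e_def)
  have cont: "continuous_on UNIV F"
    using locally_lipschitz_on_continuous[OF lip] by (simp add: continuous_at_imp_continuous_on)
  then have Fb: "F \<in> borel_measurable borel" by (rule borel_measurable_continuous_onI)
  have "set_integrable lebesgue (cball 0 R) F"
    by (rule continuous_integrable_lebesgue) (auto intro: continuous_on_subset[OF cont])
  moreover have "indicator (cball 0 R) x *\<^sub>R F x = F x" for x
    using supp by (auto simp: indicator_def)
  ultimately have Fi: "integrable lebesgue F" by (simp only: set_integrable_def)
  define s where "s k x = (F (x + (1 / real (Suc k)) *\<^sub>R e) - F x) * real (Suc k)" for k x
  have s_int: "integrable lebesgue (s k)" for k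
    unfolding s_def using integral_lebesgue_translation(1)[OF Fb Fi] Fi by simp
  have s0: "(LINT x|lebesgue. s k x) = 0" for k
    unfolding s_def using integral_lebesgue_translation[OF Fb Fi] Fi by simp
  \<comment> \<open>The shifts have length at most 1. For x within radius R + 1 both points of the
    quotient lie within radius R + 2, where L is valid; for other x both lie outside radius R, where
    F vanishes.\<close>
  obtain L where L: "L-lipschitz_on (cball 0 (R+2)) F"
    using locally_lipschitz_on_compact[OF lip compact_cball] .
  have L0: "L \<ge> 0" by (rule lipschitz_on_nonneg[OF L])
  define w where "w x = indicator (cball 0 (R+1)) x *\<^sub>R L" for x :: "real^2"
  have w: "integrable lebesgue w"
    using continuous_integrable_lebesgue[of "cball 0 (R+1)" "\<lambda>_. L"]
    unfolding w_def set_integrable_def by simp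
  have bound: "norm (s k x) \<le> w x" for k x
  proof (cases "x \<in> cball 0 (R+1)")
    case True
    define y where "y = x + (1 / real (Suc k)) *\<^sub>R e"
    have d: "dist y x = 1 / real (Suc k)" by (simp add: y_def dist_norm ne)
    have "norm y \<le> norm x + 1 / real (Suc k)"
      using norm_triangle_ineq[of x "(1 / real (Suc k)) *\<^sub>R e"] by (simp add: y_def ne)
    also have "1 / real (Suc k) \<le> 1" by simp
    finally have "y \<in> cball 0 (R+2)" "x \<in> cball 0 (R+2)" using True by auto
    then have "\<bar>F y - F x\<bar> \<le> L * (1 / real (Suc k))"
      using lipschitz_onD[OF L] d by (metis dist_real_def)
    then have "\<bar>F y - F x\<bar> * real (Suc k) \<le> L" by (simp add: field_simps)
    then show ?thesis using True by (simp add: s_def w_def y_def abs_mult)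
  next
    case False
    define y where "y = x + (1 / real (Suc k)) *\<^sub>R e"
    have "norm x \<le> norm y + 1 / real (Suc k)"
      using norm_triangle_ineq4[of y "(1 / real (Suc k)) *\<^sub>R e"] by (simp add: y_def ne)
    also have "1 / real (Suc k) \<le> 1" by simp
    finally have "y \<notin> cball 0 R" "x \<notin> cball 0 R" using False by auto
    then have "F (x + (1 / real (Suc k)) *\<^sub>R e) = 0" "F x = 0" using supp by (auto simp: y_def)
    then show ?thesis using False by (simp add: s_def w_def)
  qed
  have lim: "AE x in lebesgue. (\<lambda>k. s k x) \<longlonglongrightarrow> F' x e"
    using D unfolding s_def by eventually_elim (rule difference_quotient_tendsto)
  \<comment> \<open>F' is prescribed only almost everywhere; its measurability is inherited from the
    quotients through the limit.\<close>
  have "(\<lambda>x. lim (\<lambda>k. s k x)) \<in> borel_measurable lebesgue"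
    by (rule borel_measurable_lim_metric) (rule borel_measurable_integrable[OF s_int])
  moreover have "AE x in lebesgue. lim (\<lambda>k. s k x) = F' x e"
    using lim by eventually_elim (rule limI)
  ultimately have m: "(\<lambda>x. F' x e) \<in> borel_measurable lebesgue"
    by (rule borel_measurable_AE)
  have "(\<lambda>k. LINT x|lebesgue. s k x) \<longlonglongrightarrow> (LINT x|lebesgue. F' x e)"
    by (rule integral_dominated_convergence[OF m borel_measurable_integrable[OF s_int] w lim])
      (rule AE_I2, rule bound)
  then show ?thesis by (simp add: s0 LIMSEQ_const_iff e_def)
qed

text \<open>For partial derivatives, P selects the points of differentiability: elsewhere
  \<open>frechet_derivative\<close> is an unspecified value that no Lipschitz constant controls. The
  sum of the |M c| over a finite subcover serves as a common bound.\<close>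

lemma bounded_on_compact_if_locally_bounded:
  fixes K :: "'a::metric_space set"
  assumes "compact K" "\<And>x. x \<in> K \<Longrightarrow> \<exists>e>0. \<exists>M::real. \<forall>y\<in>ball x e. P y \<longrightarrow> h y \<le> M"
  shows "\<exists>M. \<forall>y\<in>K. P y \<longrightarrow> h y \<le> M"
proof -
  have "\<forall>x. \<exists>e M. x \<in> K \<longrightarrow> e > 0 \<and> (\<forall>y\<in>ball x e. P y \<longrightarrow> h y \<le> (M::real))"
    using assms(2) by metis
  then obtain e M where eM: "\<And>x. x \<in> K \<Longrightarrow> e x > 0"
    "\<And>x y. x \<in> K \<Longrightarrow> y \<in> ball x (e x) \<Longrightarrow> P y \<Longrightarrow> h y \<le> M x"
    by metis
  obtain C where C: "C \<subseteq> K" "finite C" "K \<subseteq> (\<Union>c\<in>C. ball c (e c))"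
    by (rule compactE_image[OF assms(1), of K "\<lambda>c. ball c (e c)"]) (use eM(1) in auto)
  have "h y \<le> (\<Sum>c\<in>C. \<bar>M c\<bar>)" if y: "y \<in> K" "P y" for y
  proof -
    obtain c where c: "c \<in> C" "y \<in> ball c (e c)" using C(3) y(1) by blast
    have "h y \<le> \<bar>M c\<bar>"
      using eM(2)[OF subsetD[OF C(1) c(1)] c(2) y(2)] by linarith
    also have "\<dots> \<le> (\<Sum>c\<in>C. \<bar>M c\<bar>)"
      by (rule member_le_sum[OF c(1)]) (use C(2) in auto)
    finally show ?thesis .
  qed
  then show ?thesis by blast
qed

lemma frechet_derivative_le_lipschitz:
  fixes f :: "real^2 \<Rightarrow> real"
  assumes L: "L-lipschitz_on (ball x e) f" and y: "y \<in> ball x e" and d: "f differentiable (at y)"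
  shows "\<bar>frechet_derivative f (at y) (axis j 1)\<bar> \<le> L"
proof (rule LIMSEQ_le_const2[OF tendsto_rabs[OF difference_quotient_tendsto]])
  show "(f has_derivative frechet_derivative f (at y)) (at y)"
    using d frechet_derivative_works by blast
  obtain r where r: "r > 0" "ball y r \<subseteq> ball x e"
    using y open_contains_ball by blast
  obtain N where N: "1 / real (Suc N) < r" using r(1) nat_approx_posE by blast
  show "\<exists>N. \<forall>k\<ge>N. \<bar>(f (y + (1 / real (Suc k)) *\<^sub>R axis j 1) - f y) * real (Suc k)\<bar> \<le> L"
  proof (intro exI allI impI)
    fix k assume "N \<le> k"
    define z :: "real^2" where "z = y + (1 / real (Suc k)) *\<^sub>R axis j 1"
    have d: "dist z y = 1 / real (Suc k)" by (simp add: z_def dist_norm)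
    also have "\<dots> \<le> 1 / real (Suc N)" using \<open>N \<le> k\<close> by (simp add: frac_le)
    finally have "z \<in> ball y r" using N by (simp add: dist_commute)
    then have "z \<in> ball x e" using r(2) by blast
    then have "\<bar>f z - f y\<bar> \<le> L * (1 / real (Suc k))"
      using lipschitz_onD[OF L _ y] d by (metis dist_real_def)
    then have "\<bar>f z - f y\<bar> * real (Suc k) \<le> L" by (simp add: field_simps)
    then show "\<bar>(f (y + (1 / real (Suc k)) *\<^sub>R axis j 1) - f y) * real (Suc k)\<bar> \<le> L"
      by (simp add: abs_mult z_def)
  qed
qed

lemma partial_measurable:
  fixes f :: "real^2 \<Rightarrow> real"
  assumes "open B" and lip: "locally_lipschitz_on B f"
    and d: "AE x in lebesgue. x \<in> B \<longrightarrow> f differentiable (at x)"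
  shows "(\<lambda>x. indicator B x *\<^sub>R frechet_derivative f (at x) (axis j 1)) \<in> borel_measurable lebesgue"
proof -
  define e :: "real^2" where "e = axis j 1"
  \<comment> \<open>Extension by 0 keeps the quotient defined when the shifted point leaves B. As B
    is open, limits at points of B do not change.\<close>
  define fB where "fB x = (if x \<in> B then f x else 0)" for x
  have c: "continuous_on B f"
    using locally_lipschitz_on_continuous[OF lip] by (simp add: continuous_at_imp_continuous_on)
  have [measurable]: "B \<in> sets borel" using \<open>open B\<close> by simp
  have [measurable]: "fB \<in> borel_measurable borel"
    unfolding fB_def[abs_def]
    by (rule borel_measurable_continuous_on_if[OF _ c]) (use \<open>open B\<close> in auto)
  define s where "s k x = indicator B x * ((fB (x + (1 / real (Suc k)) *\<^sub>R e) - fB x) * real (Suc k))" for k x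
  have "s k \<in> borel_measurable lborel" for k
    unfolding s_def[abs_def] by measurable
  then have sm: "s k \<in> borel_measurable lebesgue" for k
    by (rule measurable_completion)
  have lim: "AE x in lebesgue. lim (\<lambda>k. s k x) = indicator B x *\<^sub>R frechet_derivative f (at x) (axis j 1)"
    using d
  proof eventually_elim
    case (elim x)
    show ?case
    proof (cases "x \<in> B")
      case True
      have "(f has_derivative frechet_derivative f (at x)) (at x)"
        using elim True frechet_derivative_works by blast
      then have "(fB has_derivative frechet_derivative f (at x)) (at x)"
        by (rule has_derivative_transform_within_open[OF _ \<open>open B\<close> True]) (simp add: fB_def)
      from difference_quotient_tendsto[OF this, of e]
      have "(\<lambda>k. s k x) \<longlonglongrightarrow> frechet_derivative f (at x) e"
        using True by (simp add: s_def)
      then show ?thesis using True by (simp add: e_def limI)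
    qed (simp add: s_def limI)
  qed
  show ?thesis
    by (rule borel_measurable_AE[OF borel_measurable_lim_metric lim]) (rule sm)
qed

lemma partial_bounded_on_compact:
  fixes f :: "real^2 \<Rightarrow> real"
  assumes lip: "locally_lipschitz_on S f" and K: "compact K" "K \<subseteq> S"
  shows "\<exists>M. \<forall>y\<in>K. f differentiable (at y) \<longrightarrow> \<bar>frechet_derivative f (at y) (axis j 1)\<bar> \<le> M"
proof (rule bounded_on_compact_if_locally_bounded[OF K(1)])
  fix x assume "x \<in> K"
  then obtain e L where "e > 0" "L-lipschitz_on (ball x e) f"
    using locally_lipschitz_onE[OF lip, of x] K by blast
  then show "\<exists>e>0. \<exists>M. \<forall>y\<in>ball x e. f differentiable (at y) \<longrightarrow>
      \<bar>frechet_derivative f (at y) (axis j 1)\<bar> \<le> M"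
    using frechet_derivative_le_lipschitz by blast
qed

lemma locally_integrable_partial:
  fixes f :: "real^2 \<Rightarrow> real"
  assumes "open B" and lip: "locally_lipschitz_on B f"
    and d: "AE x in lebesgue. x \<in> B \<longrightarrow> f differentiable (at x)"
  shows "locally_integrable_on (\<lambda>x. frechet_derivative f (at x) (axis j 1)) B"
  unfolding locally_integrable_on_def
proof (intro allI impI)
  fix K assume K: "compact K \<and> K \<subseteq> B"
  let ?D = "\<lambda>x. frechet_derivative f (at x) (axis j 1)"
  have "\<exists>M. \<forall>y\<in>K. f differentiable (at y) \<longrightarrow> \<bar>?D y\<bar> \<le> M"
    by (rule partial_bounded_on_compact[OF lip]) (use K in auto)
  then obtain M where M: "\<And>y. y \<in> K \<Longrightarrow> f differentiable (at y) \<Longrightarrow> \<bar>?D y\<bar> \<le> M" by blast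
  have "K \<in> sets lebesgue" using K by (simp add: borel_compact)
  then have "(\<lambda>x. indicator K x * (indicator B x *\<^sub>R ?D x)) \<in> borel_measurable lebesgue"
    by (intro borel_measurable_times partial_measurable[OF assms] borel_measurable_indicator)
  also have "(\<lambda>x. indicator K x * (indicator B x *\<^sub>R ?D x)) = (\<lambda>x. indicator K x *\<^sub>R ?D x)"
    using K by (auto simp: indicator_def fun_eq_iff)
  finally have m: "(\<lambda>x. indicator K x *\<^sub>R ?D x) \<in> borel_measurable lebesgue" .
  have "integrable lebesgue (\<lambda>x. indicator K x *\<^sub>R M)"
    using continuous_integrable_lebesgue[of K "\<lambda>_. M"] K by (simp add: set_integrable_def)
  then show "set_integrable lebesgue K ?D"
    unfolding set_integrable_def
  proof (rule Bochner_Integration.integrable_bound[OF _ m])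
    show "AE x in lebesgue. norm (indicator K x *\<^sub>R ?D x) \<le> norm (indicator K x *\<^sub>R M)"
      using d
    proof eventually_elim
      case (elim x)
      show ?case
      proof (cases "x \<in> K")
        case True
        then have "f differentiable (at x)" using elim K by blast
        from M[OF True this] True show ?thesis by simp
      qed simp
    qed
  qed
qed

text \<open>Continuous partials are bounded on a closed ball. Expanding h in coordinates bounds the
  operator norm by M 1 + M 2, and convexity of the ball turns this into a Lipschitz
  constant.\<close>

lemma C1_locally_lipschitz:
  assumes "C_k (Suc 0) \<phi>"
  shows "locally_lipschitz_on UNIV \<phi>"
  unfolding locally_lipschitz_on_def
proof
  fix x
  have d: "\<phi> differentiable (at y)" for y using assms by auto
  have c: "continuous_on UNIV (\<lambda>y. frechet_derivative \<phi> (at y) (axis j 1))" for j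
    using assms by auto
  have "compact ((\<lambda>y. frechet_derivative \<phi> (at y) (axis j 1)) ` cball x 1)" for j
    by (intro compact_continuous_image continuous_on_subset[OF c]) auto
  from compact_imp_bounded[OF this]
  have "\<exists>M. \<forall>y\<in>cball x 1. \<bar>frechet_derivative \<phi> (at y) (axis j 1)\<bar> \<le> M" for j
    unfolding bounded_iff by simp
  then obtain M where M: "\<And>j y. y \<in> cball x 1 \<Longrightarrow> \<bar>frechet_derivative \<phi> (at y) (axis j 1)\<bar> \<le> M j"
    by metis
  have "(M 1 + M 2)-lipschitz_on (ball x 1) \<phi>"
  proof (rule bounded_derivative_imp_lipschitz)
    show "(\<phi> has_derivative frechet_derivative \<phi> (at y)) (at y within ball x 1)" if "y \<in> ball x 1" for y
      using d frechet_derivative_works has_derivative_at_withinI by blast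
    have "0 \<le> M j" for j using M[of x j] by (smt (verit) centre_in_cball zero_le_one)
    then show "0 \<le> M 1 + M 2" by (simp add: add_nonneg_nonneg)
    show "onorm (frechet_derivative \<phi> (at y)) \<le> M 1 + M 2" if "y \<in> ball x 1" for y
    proof (rule onorm_le)
      fix h :: "real^2"
      let ?F = "frechet_derivative \<phi> (at y)"
      have lin: "linear ?F" using d by (rule linear_frechet_derivative)
      have "h = h$1 *\<^sub>R axis 1 1 + h$2 *\<^sub>R axis 2 1" by (simp add: vec_eq_iff forall_2)
      then have "?F h = ?F (h$1 *\<^sub>R axis 1 1 + h$2 *\<^sub>R axis 2 1)" by simp
      also have "\<dots> = h$1 * ?F (axis 1 1) + h$2 * ?F (axis 2 1)"
        by (simp add: linear_add[OF lin] linear_cmul[OF lin])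
      also have "\<bar>\<dots>\<bar> \<le> \<bar>h$1\<bar> * \<bar>?F (axis 1 1)\<bar> + \<bar>h$2\<bar> * \<bar>?F (axis 2 1)\<bar>"
        by (rule order_trans[OF abs_triangle_ineq]) (simp add: abs_mult)
      also have "\<dots> \<le> norm h * M 1 + norm h * M 2"
        using M[of y] that by (intro add_mono mult_mono component_le_norm_cart) auto
      finally show "norm (?F h) \<le> (M 1 + M 2) * norm h" by (simp add: algebra_simps)
    qed
  qed simp
  then show "\<exists>e>0. \<exists>L. L-lipschitz_on (ball x e) \<phi>" using zero_less_one by blast
qed

lemma set_integrable_times_compactly_supported:
  fixes g \<psi> :: "real^2 \<Rightarrow> real"
  assumes g: "locally_integrable_on g B" and K: "compact K" "K \<subseteq> B"
    and c: "continuous_on UNIV \<psi>" and z: "\<And>x. x \<notin> K \<Longrightarrow> \<psi> x = 0"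
  shows "set_integrable lebesgue B (\<lambda>x. g x * \<psi> x)"
proof -
  have "bounded (\<psi> ` K)"
    by (rule compact_imp_bounded[OF compact_continuous_image[OF continuous_on_subset[OF c subset_UNIV] K(1)]])
  then obtain M where M: "\<And>x. x \<in> K \<Longrightarrow> \<bar>\<psi> x\<bar> \<le> M" by (auto simp: bounded_iff)
  have i: "integrable lebesgue (\<lambda>x. indicator K x *\<^sub>R g x)"
    using g K by (simp add: locally_integrable_on_def set_integrable_def)
  have "\<psi> \<in> borel_measurable lborel" using c borel_measurable_continuous_onI by simp
  then have "\<psi> \<in> borel_measurable lebesgue" by (rule measurable_completion)
  then have m: "(\<lambda>x. (indicator K x *\<^sub>R g x) * \<psi> x) \<in> borel_measurable lebesgue"
    using borel_measurable_integrable[OF i] by (rule borel_measurable_times[rotated])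
  have "integrable lebesgue (\<lambda>x. (indicator K x *\<^sub>R g x) * \<psi> x)"
  proof (rule Bochner_Integration.integrable_bound[OF integrable_mult_left[OF i, of M] m])
    show "AE x in lebesgue. norm ((indicator K x *\<^sub>R g x) * \<psi> x) \<le> norm (indicator K x *\<^sub>R g x * M)"
    proof (rule AE_I2)
      fix x
      show "norm ((indicator K x *\<^sub>R g x) * \<psi> x) \<le> norm (indicator K x *\<^sub>R g x * M)"
        using M[of x] by (cases "x \<in> K") (auto simp: abs_mult intro!: mult_left_mono)
    qed
  qed
  moreover have "(indicator K x *\<^sub>R g x) * \<psi> x = indicator B x *\<^sub>R (g x * \<psi> x)" for x
    using z[of x] K(2) by (auto simp: indicator_def)
  ultimately show ?thesis by (simp only: set_integrable_def)
qed

text \<open>The product of f and a test function, extended by 0, is locally Lipschitz on the whole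
  plane, because B and the complement of the support are open and cover it. That its partial
  derivative integrates to 0 is then integration by parts.\<close>

proposition locally_lipschitz_has_weak_partial:
  fixes f :: "real^2 \<Rightarrow> real"
  assumes "open B" and lip: "locally_lipschitz_on B f"
    and d: "AE x in lebesgue. x \<in> B \<longrightarrow> f differentiable (at x)"
  shows "has_weak_partial B f j (\<lambda>x. frechet_derivative f (at x) (axis j 1))"
  unfolding has_weak_partial_def
proof (intro conjI allI impI)
  let ?D = "\<lambda>x. frechet_derivative f (at x) (axis j 1)"
  have cont: "continuous_on B f"
    using locally_lipschitz_on_continuous[OF lip] by (simp add: continuous_at_imp_continuous_on)
  show fi: "locally_integrable_on f B"
    unfolding locally_integrable_on_def
    using continuous_integrable_lebesgue continuous_on_subset[OF cont] by blast
  show Di: "locally_integrable_on ?D B"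
    by (rule locally_integrable_partial[OF assms])
  fix \<phi> assume t: "test_function B \<phi>"
  let ?d\<phi> = "\<lambda>x. frechet_derivative \<phi> (at x) (axis j 1)"
  define K where "K = closure {x. \<phi> x \<noteq> 0}"
  have K: "compact K" "K \<subseteq> B" using t by (auto simp: test_function_def K_def)
  have K0: "\<phi> x = 0" "?d\<phi> x = 0" if "x \<notin> K" for x
    using that closure_subset[of "{x. \<phi> x \<noteq> 0}"] frechet_derivative_zero_outside_support[of x \<phi>]
    by (auto simp: K_def)
  have C1: "C_k (Suc 0) \<phi>" "C_k 0 \<phi>" using t unfolding test_function_def by blast+
  define F where "F x = (if x \<in> B then f x * \<phi> x else 0)" for x
  define F' where "F' x = (\<lambda>h. indicator B x * (f x * frechet_derivative \<phi> (at x) h + frechet_derivative f (at x) h * \<phi> x))" for x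
  have "locally_lipschitz_on {x} F" for x
  proof (cases "x \<in> B")
    case True
    have "locally_lipschitz_on {x} (\<lambda>x. f x * \<phi> x)"
      using True locally_lipschitz_on_subset[OF lip] locally_lipschitz_on_subset[OF C1_locally_lipschitz[OF C1(1)]]
      by (intro locally_lipschitz_on_mult) auto
    then show ?thesis
      by (rule locally_lipschitz_on_transform[rotated 3]) (use True \<open>open B\<close> in \<open>auto simp: F_def\<close>)
  next
    case False
    have "locally_lipschitz_on {x} (\<lambda>_. 0)" by (rule locally_lipschitz_on_const)
    then show ?thesis
      by (rule locally_lipschitz_on_transform[of _ "- K", rotated 3])
        (use False K compact_imp_closed in \<open>auto simp: F_def K0\<close>)
  qed
  then have Flip: "locally_lipschitz_on UNIV F"
    by (subst locally_lipschitz_on_pointwise) blast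
  obtain R where R: "\<And>x. x \<notin> cball 0 R \<Longrightarrow> x \<notin> K"
    using compact_imp_bounded[OF K(1)] unfolding bounded_iff by (auto simp: subset_iff)
  have Fd: "AE x in lebesgue. (F has_derivative F' x) (at x)"
    using d
  proof eventually_elim
    case (elim x)
    show ?case
    proof (cases "x \<in> B")
      case True
      have 1: "(f has_derivative frechet_derivative f (at x)) (at x)"
        using elim True frechet_derivative_works by blast
      have 2: "(\<phi> has_derivative frechet_derivative \<phi> (at x)) (at x)"
        using C1(1) frechet_derivative_works by auto
      have "((\<lambda>x. f x * \<phi> x) has_derivative F' x) (at x)"
        using has_derivative_mult[OF 1 2] True by (simp add: F'_def)
      then show ?thesis
        by (rule has_derivative_transform_within_open[OF _ \<open>open B\<close> True]) (simp add: F_def)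
    next
      case False
      have "((\<lambda>_. 0) has_derivative F' x) (at x)"
        using False by (simp add: F'_def)
      then show ?thesis
        by (rule has_derivative_transform_within_open[of _ _ _ _ "- K"])
          (use False K compact_imp_closed in \<open>auto simp: F_def K0\<close>)
    qed
  qed
  have "(LINT x|lebesgue. F' x (axis j 1)) = 0"
    by (rule integral_partial_derivative_eq_0[OF Flip _ Fd, of R]) (use R K0 in \<open>auto simp: F_def\<close>)
  then have "(LINT x:B|lebesgue. f x * ?d\<phi> x + ?D x * \<phi> x) = 0"
    by (simp add: set_lebesgue_integral_def F'_def)
  moreover have "set_integrable lebesgue B (\<lambda>x. f x * ?d\<phi> x)"
    by (rule set_integrable_times_compactly_supported[OF fi K]) (use C1 K0 in auto)
  moreover have "set_integrable lebesgue B (\<lambda>x. ?D x * \<phi> x)"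
    by (rule set_integrable_times_compactly_supported[OF Di K]) (use C1 K0 in auto)
  ultimately show "(LINT x:B|lebesgue. f x * ?d\<phi> x) = - (LINT x:B|lebesgue. ?D x * \<phi> x)"
    using set_integral_add(2) by fastforce
qed

subsection \<open>Energies of admissible deformations\<close>

lemma open_annulus: "open (annulus r0)"
proof -
  have "annulus r0 = norm -` {r0<..<1}" by (auto simp: annulus_def)
  then show ?thesis using open_vimage[of "{r0<..<1}" norm] by (simp add: continuous_on_norm_id)
qed

lemma elastic_density_eq:
  "elastic_density \<nu> A = 1 / (1 - \<nu>) * (A$1$1 + A$2$2)\<^sup>2 - 2 * (A$1$1 * A$2$2 - A$1$2 * A$2$1)"
  by (simp add: elastic_density_def trace_def sum_2 det_2)

text \<open>The bound \<nu> > -1 gives 1 / (1 - \<nu>) \<ge> 1/2. With 1/2 in its place the density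
  of a symmetric matrix is a sum of squares, one of the difference of the diagonal entries and one
  of the off-diagonal entry.\<close>

lemma elastic_density_nonneg:
  assumes "-1 < \<nu>" "\<nu> < 1" "A$1$2 = A$2$1"
  shows "elastic_density \<nu> A \<ge> 0"
proof -
  have "1/2 \<le> 1 / (1 - \<nu>)" using assms by (simp add: field_simps)
  then have "1/2 * (A$1$1 + A$2$2)\<^sup>2 \<le> 1 / (1 - \<nu>) * (A$1$1 + A$2$2)\<^sup>2"
    by (rule mult_right_mono) simp
  moreover have "1/2 * (A$1$1 + A$2$2)\<^sup>2 - 2 * (A$1$1 * A$2$2 - A$1$2 * A$1$2)
      = 1/2 * (A$1$1 - A$2$2)\<^sup>2 + 2 * (A$1$2)\<^sup>2"
    by (simp add: power2_eq_square algebra_simps)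
  moreover have "0 \<le> 1/2 * (A$1$1 - A$2$2)\<^sup>2 + 2 * (A$1$2)\<^sup>2" by simp
  ultimately show ?thesis unfolding elastic_density_eq assms(3)[symmetric] by linarith
qed

lemma set_integral_nonneg_AE:
  fixes f :: "real^2 \<Rightarrow> real"
  assumes "AE x in lebesgue. x \<in> B \<longrightarrow> 0 \<le> f x"
  shows "0 \<le> (LINT x:B|lebesgue. f x)"
  unfolding set_lebesgue_integral_def
  by (rule integral_nonneg_AE, use assms in eventually_elim) (auto simp: indicator_def)

lemma transpose_rowvector_mult_nth:
  fixes v :: "real^2"
  shows "(transpose (rowvector v :: real^2^1) ** (rowvector v :: real^2^1)) $ i $ j = v$i * v$j"
  by (simp add: matrix_matrix_mult_def transpose_def rowvector_def)

lemma metric_g1_nth: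
  "metric_g1 x $ 1 $ 1 = (x$2)\<^sup>2 / 3" "metric_g1 x $ 1 $ 2 = - (x$1 * x$2) / 3"
  "metric_g1 x $ 2 $ 1 = - (x$1 * x$2) / 3" "metric_g1 x $ 2 $ 2 = (x$1)\<^sup>2 / 3"
  by (simp_all add: metric_g1_def)

lemma strain_nth:
  "strain r0 (u, \<eta>) x $ i $ j =
     weak_partial (annulus r0) i (\<lambda>y. u y $ j) x + weak_partial (annulus r0) j (\<lambda>y. u y $ i) x
     + weak_partial (annulus r0) i \<eta> x * weak_partial (annulus r0) j \<eta> x - metric_g1 x $ i $ j"
  by (simp add: strain_def weak_gradient_def transpose_rowvector_mult_nth weak_jacobian_def)
    (simp add: transpose_def)

lemma strain_sym: "strain r0 (u, \<eta>) x $ 1 $ 2 = strain r0 (u, \<eta>) x $ 2 $ 1"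
  by (simp add: strain_nth metric_g1_nth)

lemma stretching_energy_nonneg:
  assumes "-1 < \<nu>" "\<nu> < 1"
  shows "0 \<le> stretching_energy r0 \<nu> (u, \<eta>)"
  unfolding stretching_energy_def
  by (intro set_integral_nonneg_AE AE_I2 impI elastic_density_nonneg assms strain_sym)

text \<open>The strain is symmetric at every point by its form. The mixed entries of the weak
  Hessian come from independently selected representatives, so they agree only almost
  everywhere.\<close>

lemma bending_energy_nonneg:
  assumes "-1 < \<nu>" "\<nu> < 1" "\<eta> \<in> W22 (annulus r0)"
  shows "0 \<le> bending_energy r0 \<nu> (u, \<eta>)"
proof -
  let ?B = "annulus r0"
  have g: "\<exists>g. has_weak_partial ?B \<eta> j g \<and> g \<in> W12 ?B" for j
    using assms(3) by (simp add: W22_def)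
  have wp: "has_weak_partial ?B \<eta> i (weak_partial ?B i \<eta>)" for i
    using g weak_partial_works by blast
  have wpp: "has_weak_partial ?B (weak_partial ?B i \<eta>) j (weak_partial ?B j (weak_partial ?B i \<eta>))" for i j
  proof -
    obtain g where g: "has_weak_partial ?B \<eta> i g" "g \<in> W12 ?B" using g by blast
    then obtain h where "has_weak_partial ?B g j h" unfolding W12_def by blast
    then show ?thesis by (rule weak_partial_weak_partial(1)[OF open_annulus g(1)])
  qed
  have "AE x in lebesgue. x \<in> ?B \<longrightarrow>
      weak_partial ?B 2 (weak_partial ?B 1 \<eta>) x = weak_partial ?B 1 (weak_partial ?B 2 \<eta>) x"
    by (rule weak_partials_commute[OF open_annulus wp wp wpp wpp])
  then have "AE x in lebesgue. x \<in> ?B \<longrightarrow> 0 \<le> elastic_density \<nu> (weak_hessian ?B \<eta> x)"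
    by eventually_elim (intro impI elastic_density_nonneg assms, simp add: weak_hessian_def)
  then show ?thesis
    unfolding bending_energy_def by (simp add: set_integral_nonneg_AE)
qed

lemma energy_nonneg:
  assumes "-1 < \<nu>" "\<nu> < 1" "d \<in> admissible r0"
  shows "0 \<le> energy r0 \<nu> \<tau> d"
proof -
  obtain u \<eta> where d: "d = (u, \<eta>)" by force
  with assms(3) have "\<eta> \<in> W22 (annulus r0)" by (simp add: admissible_def)
  then show ?thesis
    unfolding energy_def d
    using stretching_energy_nonneg[OF assms(1,2)] bending_energy_nonneg[OF assms(1,2)] by simp
qed

lemma periodic_admissible_subset: "periodic_admissible r0 n \<subseteq> admissible r0"
  by (auto simp: periodic_admissible_def)

lemma flat_subset_periodic: "flat_admissible r0 \<subseteq> periodic_admissible r0 n"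
  unfolding flat_admissible_def periodic_admissible_def by (auto intro!: exI[of _ "\<lambda>_. 0"])

text \<open>The zero deformation is a member. Nonemptiness is required to compare infima, as the
  infimum of the empty set of reals carries no information.\<close>

lemma flat_admissible_nonempty: "flat_admissible r0 \<noteq> {}"
proof -
  let ?z = "\<lambda>_::real^2. 0::real"
  have L: "L2_on B ?z" for B by (simp add: L2_on_def set_borel_measurable_def set_integrable_def)
  have D: "has_weak_partial B ?z j ?z" for B j
    by (simp add: has_weak_partial_def locally_integrable_on_def set_integrable_def)
  have W: "?z \<in> W12 B" for B unfolding W12_def using L D by blast
  then have "?z \<in> W22 B" for B unfolding W22_def using L D by blast
  then have "(\<lambda>_. 0, ?z) \<in> flat_admissible r0"
    using W by (simp add: flat_admissible_def admissible_def)
  then show ?thesis by blast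
qed

lemma L2_on_bounded:
  fixes f :: "real^2 \<Rightarrow> real"
  assumes B: "B \<in> sets lebesgue" "bounded B" and m: "(\<lambda>x. indicator B x *\<^sub>R f x) \<in> borel_measurable lebesgue"
    and M: "AE x in lebesgue. x \<in> B \<longrightarrow> \<bar>f x\<bar> \<le> M"
  shows "L2_on B f"
  unfolding L2_on_def
proof
  show "set_borel_measurable lebesgue B f" using m by (simp add: set_borel_measurable_def)
  have "(\<lambda>x. (indicator B x *\<^sub>R f x) * (indicator B x *\<^sub>R f x)) \<in> borel_measurable lebesgue"
    by (intro borel_measurable_times m)
  also have "(\<lambda>x. (indicator B x *\<^sub>R f x) * (indicator B x *\<^sub>R f x)) = (\<lambda>x. indicator B x *\<^sub>R (f x)\<^sup>2)"
    by (auto simp: fun_eq_iff indicator_def power2_eq_square)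
  finally have m2: "(\<lambda>x. indicator B x *\<^sub>R (f x)\<^sup>2) \<in> borel_measurable lebesgue" .
  have "B \<in> lmeasurable" using B by (simp add: bounded_set_imp_lmeasurable)
  then have "integrable lebesgue (indicator B :: _ \<Rightarrow> real)"
    by (auto simp: fmeasurable_def intro: integrable_real_indicator)
  then have "integrable lebesgue (\<lambda>x. indicator B x *\<^sub>R M\<^sup>2)"
    by (rule integrable_scaleR_left[OF _])
  then show "set_integrable lebesgue B (\<lambda>x. (f x)\<^sup>2)"
    unfolding set_integrable_def
  proof (rule Bochner_Integration.integrable_bound[OF _ m2])
    show "AE x in lebesgue. norm (indicator B x *\<^sub>R (f x)\<^sup>2) \<le> norm (indicator B x *\<^sub>R M\<^sup>2)"
      using M by eventually_elim (auto simp: indicator_def abs_le_square_iff[symmetric])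
  qed
qed

text \<open>Local Lipschitz bounds on B alone may degenerate towards its boundary. The compact set K
  between B and S makes the bounds on f and its partials uniform, and B is bounded, so both are
  square integrable.\<close>

lemma locally_lipschitz_W12:
  fixes f :: "real^2 \<Rightarrow> real"
  assumes B: "open B" "B \<subseteq> K" and K: "compact K" "K \<subseteq> S" and lip: "locally_lipschitz_on S f"
    and d: "AE x in lebesgue. x \<in> B \<longrightarrow> f differentiable (at x)"
  shows "L2_on B f" "L2_on B (\<lambda>x. frechet_derivative f (at x) (axis j 1))"
    "has_weak_partial B f j (\<lambda>x. frechet_derivative f (at x) (axis j 1))" "f \<in> W12 B"
proof -
  have lipB: "locally_lipschitz_on B f" using locally_lipschitz_on_subset[OF lip] B K by blast
  show *: "has_weak_partial B f j (\<lambda>x. frechet_derivative f (at x) (axis j 1))" for j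
    by (rule locally_lipschitz_has_weak_partial[OF \<open>open B\<close> lipB d])
  have bB: "bounded B" using B K compact_imp_bounded bounded_subset by blast
  have BL: "B \<in> sets lebesgue" using \<open>open B\<close> by simp
  show L: "L2_on B f"
  proof -
    have "continuous_on B f"
      using locally_lipschitz_on_continuous[OF lipB] by (simp add: continuous_at_imp_continuous_on)
    then have "(\<lambda>x. indicator B x *\<^sub>R f x) \<in> borel_measurable borel"
      by (rule borel_measurable_continuous_on_indicator[rotated]) (use \<open>open B\<close> in simp)
    then have "(\<lambda>x. indicator B x *\<^sub>R f x) \<in> borel_measurable lborel" by simp
    then have m: "(\<lambda>x. indicator B x *\<^sub>R f x) \<in> borel_measurable lebesgue"
      by (rule measurable_completion)
    have "\<exists>M. \<forall>y\<in>K. True \<longrightarrow> \<bar>f y\<bar> \<le> M"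
    proof (rule bounded_on_compact_if_locally_bounded[OF K(1)])
      fix x assume "x \<in> K"
      then obtain e L where "e > 0" "L-lipschitz_on (ball x e) f"
        using locally_lipschitz_onE[OF lip, of x] K(2) by blast
      then show "\<exists>e>0. \<exists>M. \<forall>y\<in>ball x e. True \<longrightarrow> \<bar>f y\<bar> \<le> M"
        using lipschitz_on_ball_bounded by blast
    qed
    then obtain M where "\<And>y. y \<in> B \<Longrightarrow> \<bar>f y\<bar> \<le> M" using B(2) by blast
    then show ?thesis by (intro L2_on_bounded[OF BL bB m, of M]) auto
  qed
  show LD: "L2_on B (\<lambda>x. frechet_derivative f (at x) (axis j 1))" for j
  proof -
    let ?D = "\<lambda>x. frechet_derivative f (at x) (axis j 1)"
    have "\<exists>M. \<forall>y\<in>K. f differentiable (at y) \<longrightarrow> \<bar>?D y\<bar> \<le> M"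
      by (rule partial_bounded_on_compact[OF lip K])
    then obtain M where M: "\<And>y. y \<in> B \<Longrightarrow> f differentiable (at y) \<Longrightarrow> \<bar>?D y\<bar> \<le> M"
      using B(2) by blast
    show ?thesis
      by (rule L2_on_bounded[OF BL bB partial_measurable[OF \<open>open B\<close> lipB d], where M = M])
        (use d in eventually_elim, use M in blast)
  qed
  show "f \<in> W12 B" unfolding W12_def using L LD * by blast
qed

subsection \<open>A piecewise quadratic isometric immersion with \<open>n\<close> waves\<close>

definition alt_sign :: "int \<Rightarrow> real" where
  "alt_sign k = (if even k then 1 else -1)"

lemma alt_sign_simps:
  "alt_sign (k + 1) = - alt_sign k" "alt_sign (k - 1) = - alt_sign k"
  "alt_sign k * alt_sign k = 1"
  by (auto simp: alt_sign_def)

text \<open>The angular part of the height, which is r^2 times it. The absolute value makes the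
  profile odd in s, so that the same expression stays correct just below a ray.\<close>

definition wave :: "real \<Rightarrow> real \<Rightarrow> real" where
  "wave \<alpha> \<theta> = (let k = \<lfloor>\<theta> / \<alpha>\<rfloor>; s = \<theta> - of_int k * \<alpha>
     in alt_sign k * (sin s * (cos s - cot \<alpha> * \<bar>sin s\<bar>)))"

lemma wave_shift:
  assumes "\<alpha> > 0"
  shows "wave \<alpha> (\<theta> + \<alpha>) = - wave \<alpha> \<theta>"
proof -
  have 1: "\<lfloor>(\<theta> + \<alpha>) / \<alpha>\<rfloor> = \<lfloor>\<theta> / \<alpha>\<rfloor> + 1" using assms by (simp add: add_divide_distrib)
  have 2: "\<theta> + \<alpha> - of_int (\<lfloor>\<theta> / \<alpha>\<rfloor> + 1) * \<alpha> = \<theta> - of_int \<lfloor>\<theta> / \<alpha>\<rfloor> * \<alpha>"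
    by (simp add: algebra_simps)
  show ?thesis unfolding wave_def Let_def 1 2 alt_sign_simps by simp
qed

lemma wave_shift_nat:
  assumes "\<alpha> > 0"
  shows "wave \<alpha> (\<theta> + real m * \<alpha>) = (-1) ^ m * wave \<alpha> \<theta>"
proof (induction m)
  case (Suc m)
  have "\<theta> + real (Suc m) * \<alpha> = \<theta> + real m * \<alpha> + \<alpha>" by (simp add: algebra_simps)
  then show ?case using Suc wave_shift[OF assms, of "\<theta> + real m * \<alpha>"] by (simp only: power_Suc)
qed simp

lemma wave_2pi_nat:
  assumes "n > 0"
  shows "wave (pi / real n) (\<theta> + 2 * pi * real m) = wave (pi / real n) \<theta>"
proof -
  \<comment> \<open>A full turn consists of 2n sectors, an even number of sign changes.\<close>
  have "\<theta> + 2 * pi * real m = \<theta> + real (2 * n * m) * (pi / real n)"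
    using assms by simp
  moreover have "wave (pi / real n) (\<theta> + real (2 * n * m) * (pi / real n)) = wave (pi / real n) \<theta>"
    by (subst wave_shift_nat) (use assms in simp_all)
  ultimately show ?thesis by (simp only:)
qed

lemma wave_2pi:
  assumes "n > 0"
  shows "wave (pi / real n) (\<theta> + 2 * pi * of_int m) = wave (pi / real n) \<theta>"
proof (cases "m \<ge> 0")
  case True
  then show ?thesis using wave_2pi_nat[OF assms, of \<theta> "nat m"] by simp
next
  case False
  then show ?thesis
    using wave_2pi_nat[OF assms, of "\<theta> + 2 * pi * of_int m" "nat (- m)"] by simp
qed

text \<open>Odd reflection across the ray \<open>k \<alpha>\<close> continues the profile on the sector above it by the one
  below.\<close>

lemma wave_near_ray:
  assumes al: "0 < \<alpha>" "\<alpha> < pi" and s: "\<bar>s\<bar> < \<alpha>"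
  shows "wave \<alpha> (of_int k * \<alpha> + s) = alt_sign k * (sin s * (cos s - cot \<alpha> * \<bar>sin s\<bar>))"
proof (cases "s \<ge> 0")
  case True
  have "(of_int k * \<alpha> + s) / \<alpha> = of_int k + s / \<alpha>" using al by (simp add: field_simps)
  moreover have "\<lfloor>s / \<alpha>\<rfloor> = 0" using al s True by (simp add: floor_eq_iff)
  ultimately have "\<lfloor>(of_int k * \<alpha> + s) / \<alpha>\<rfloor> = k" by simp
  then show ?thesis by (simp add: wave_def Let_def)
next
  case False
  have "(of_int k * \<alpha> + s) / \<alpha> = of_int k + s / \<alpha>" using al by (simp add: field_simps)
  moreover have "\<lfloor>s / \<alpha>\<rfloor> = -1" using al s False by (simp add: floor_eq_iff field_simps)
  ultimately have fl: "\<lfloor>(of_int k * \<alpha> + s) / \<alpha>\<rfloor> = k - 1" by simp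
  have sa: "sin \<alpha> > 0" using al by (simp add: sin_gt_zero)
  have 1: "sin (s + \<alpha>) \<ge> 0" using al s False by (intro sin_ge_zero) auto
  have 2: "sin s \<le> 0" using al s False sin_ge_zero[of "- s"] by simp
  \<comment> \<open>Over the denominator sin \<alpha> the profile of the lower sector becomes - sin
    (s + \<alpha>) sin s and the claimed one becomes sin s sin (s + \<alpha>). The opposite sign is
    the one between \<open>alt_sign (k - 1)\<close> and \<open>alt_sign k\<close>.\<close>
  have "cos (s + \<alpha>) - cot \<alpha> * sin (s + \<alpha>) = - sin s / sin \<alpha>"
  proof -
    have "(cos (s + \<alpha>) - cot \<alpha> * sin (s + \<alpha>)) * sin \<alpha> = sin \<alpha> * cos (s + \<alpha>) - cos \<alpha> * sin (s + \<alpha>)"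
      using sa by (simp add: cot_def field_simps)
    also have "\<dots> = sin (\<alpha> - (s + \<alpha>))" by (rule sin_diff[symmetric])
    finally show ?thesis using sa by (simp add: field_simps)
  qed
  moreover have "cos s + cot \<alpha> * sin s = sin (s + \<alpha>) / sin \<alpha>"
    using sa by (simp add: cot_def sin_add field_simps)
  ultimately have "sin (s + \<alpha>) * (cos (s + \<alpha>) - cot \<alpha> * \<bar>sin (s + \<alpha>)\<bar>)
      = - (sin s * (cos s - cot \<alpha> * \<bar>sin s\<bar>))"
    using 1 2 by simp
  moreover have e: "of_int k * \<alpha> + s - of_int (k - 1) * \<alpha> = s + \<alpha>" by (simp add: algebra_simps)
  ultimately show ?thesis unfolding wave_def Let_def fl e alt_sign_simps by simp
qed

section \<open>Polar coordinates and the height function\<close>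

lemma polar_nth [simp]: "polar r \<theta> $ 1 = r * cos \<theta>" "polar r \<theta> $ 2 = r * sin \<theta>"
  by (simp_all add: polar_def)

lemma norm_vec2: "norm (x::real^2) = sqrt ((x$1)\<^sup>2 + (x$2)\<^sup>2)"
  by (simp add: norm_vec_def L2_set_def sum_2)

lemma norm_polar: "r \<ge> 0 \<Longrightarrow> norm (polar r \<theta>) = r"
  by (simp add: norm_vec2 power_mult_distrib flip: distrib_left)

lemma polar_exists: "\<exists>\<theta>. x = polar (norm x) \<theta>"
proof (cases "x = 0")
  case True
  then show ?thesis by (simp add: vec_eq_iff forall_2)
next
  case False
  then have "norm x > 0" by simp
  have "(x$1 / norm x)\<^sup>2 + (x$2 / norm x)\<^sup>2 = ((x$1)\<^sup>2 + (x$2)\<^sup>2) / (norm x)\<^sup>2"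
    by (simp add: power_divide add_divide_distrib)
  also have "(x$1)\<^sup>2 + (x$2)\<^sup>2 = (norm x)\<^sup>2" by (simp add: norm_vec2)
  also have "(norm x)\<^sup>2 / (norm x)\<^sup>2 = 1" using \<open>norm x > 0\<close> by simp
  finally obtain t where t: "x$1 / norm x = cos t" "x$2 / norm x = sin t"
    by (rule sincos_total_2pi)
  then have "x = polar (norm x) t"
    using \<open>norm x > 0\<close> by (simp add: vec_eq_iff forall_2 t[symmetric])
  then show ?thesis ..
qed

text \<open>The angle is an arbitrary choice; \<open>height_polar\<close> removes the dependence on
  it by the 2 pi periodicity of the profile.\<close>

definition height :: "nat \<Rightarrow> real^2 \<Rightarrow> real" where
  "height n x = (norm x)\<^sup>2 * wave (pi / real n) (SOME \<theta>. x = polar (norm x) \<theta>)"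

lemma height_polar:
  assumes "r > 0" "n > 0"
  shows "height n (polar r \<theta>) = r\<^sup>2 * wave (pi / real n) \<theta>"
proof -
  define t where "t = (SOME t. polar r \<theta> = polar (norm (polar r \<theta>)) t)"
  have "polar r \<theta> = polar (norm (polar r \<theta>)) t"
    unfolding t_def using polar_exists by (rule someI_ex)
  then have "polar r \<theta> = polar r t" using assms by (simp add: norm_polar)
  then have "sin \<theta> = sin t" "cos \<theta> = cos t" using assms by (auto simp: vec_eq_iff forall_2)
  then obtain m :: int where "\<theta> = t + 2 * pi * of_int m"
    using sin_cos_eq_iff by metis
  then have "wave (pi / real n) \<theta> = wave (pi / real n) t" using wave_2pi[OF assms(2)] by simp
  then show ?thesis unfolding height_def t_def[symmetric] using assms by (simp add: norm_polar)
qed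

lemma has_real_derivative_abs:
  assumes "t \<noteq> 0"
  shows "((\<lambda>t. \<bar>t\<bar>) has_real_derivative sgn t) (at t)"
proof (rule has_field_derivative_transform_within[OF DERIV_cmult_Id[of "sgn t"] _ UNIV_I])
  show "0 < \<bar>t\<bar>" using assms by simp
  show "sgn t * y = \<bar>y\<bar>" if "dist y t < \<bar>t\<bar>" for y
    using that by (auto simp: dist_real_def abs_if sgn_if split: if_splits)
qed

text \<open>The kink of |t| at 0 disappears in t |t|. This is why the reflected height is
  differentiable on the rays themselves.\<close>

lemma has_real_derivative_mult_abs: "((\<lambda>t. t * \<bar>t\<bar>) has_real_derivative 2 * \<bar>t\<bar>) (at t)"
proof (cases "t = 0")
  case True
  have "((\<lambda>y::real. \<bar>y\<bar>) \<longlongrightarrow> 0) (at 0)" by (intro tendsto_eq_intros) auto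
  then have "((\<lambda>y::real. (y * \<bar>y\<bar> - 0 * \<bar>0\<bar>) / (y - 0)) \<longlongrightarrow> 0) (at 0)"
    by (rule Lim_transform_eventually) (auto simp: eventually_at_filter)
  then show ?thesis using True by (simp add: has_field_derivative_iff)
next
  case False
  from DERIV_mult[OF DERIV_ident has_real_derivative_abs[OF False]]
  show ?thesis by (simp add: sgn_if abs_if split: if_splits)
qed

text \<open>In coordinates a, b rotated by the angle with cosine C and sine S, the left sides are
  the entries of \<nabla>\<eta> \<otimes> \<nabla>\<eta> - 2 \<eta> H for \<eta> = \<sigma> (a b - c
  b^2). Since a C - b S and a S + b C are the original coordinates, the right sides are the entries
  of 3 g1.\<close>

lemma quadratic_strain_identities:
  fixes \<sigma> c C S a b :: real
  assumes "\<sigma>\<^sup>2 = 1" "C\<^sup>2 + S\<^sup>2 = 1"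
  shows "(\<sigma> * (b * C - (a - 2 * c * b) * S))\<^sup>2 - 2 * (\<sigma> * (a * b - c * b\<^sup>2)) * (\<sigma> * (- 2 * C * S - 2 * c * S\<^sup>2))
      = (a * S + b * C)\<^sup>2"
    "(\<sigma> * (b * S + (a - 2 * c * b) * C))\<^sup>2 - 2 * (\<sigma> * (a * b - c * b\<^sup>2)) * (\<sigma> * (2 * C * S - 2 * c * C\<^sup>2))
      = (a * C - b * S)\<^sup>2"
    "(\<sigma> * (b * C - (a - 2 * c * b) * S)) * (\<sigma> * (b * S + (a - 2 * c * b) * C))
       - 2 * (\<sigma> * (a * b - c * b\<^sup>2)) * (\<sigma> * (C\<^sup>2 - S\<^sup>2 + 2 * c * C * S))
      = - ((a * C - b * S) * (a * S + b * C))"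
  using assms by algebra+

text \<open>Determinant and squared trace of the Hessian of the same form; both are independent of
  the rotation.\<close>

lemma quadratic_hessian_identities:
  fixes \<sigma> c C S :: real
  assumes "\<sigma>\<^sup>2 = 1" "C\<^sup>2 + S\<^sup>2 = 1"
  shows "(\<sigma> * (- 2 * C * S - 2 * c * S\<^sup>2)) * (\<sigma> * (2 * C * S - 2 * c * C\<^sup>2)) - (\<sigma> * (C\<^sup>2 - S\<^sup>2 + 2 * c * C * S))\<^sup>2 = -1"
    "(\<sigma> * (- 2 * C * S - 2 * c * S\<^sup>2) + \<sigma> * (2 * C * S - 2 * c * C\<^sup>2))\<^sup>2 = 4 * c\<^sup>2"
  using assms by algebra+

section \<open>Local description of the height around each ray\<close>

context
  fixes n :: nat
  assumes n: "n \<ge> 2"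
begin

abbreviation "al \<equiv> pi / real n"

lemma al: "0 < al" "al \<le> pi/2" "al < pi"
proof -
  show 1: "0 < al" using n by simp
  show 2: "al \<le> pi/2" using n by (simp add: field_simps)
  show "al < pi" using 2 pi_gt_zero by linarith
qed

definition par :: "int \<Rightarrow> real^2 \<Rightarrow> real" where
  "par k x = x$1 * cos (of_int k * al) + x$2 * sin (of_int k * al)"

definition perp :: "int \<Rightarrow> real^2 \<Rightarrow> real" where
  "perp k x = x$2 * cos (of_int k * al) - x$1 * sin (of_int k * al)"

text \<open>At polar angle k \<alpha> + s this is r^2 times the expression in
  \<open>wave_near_ray\<close>, so one formula covers both sides of the ray.\<close>

definition chart :: "int \<Rightarrow> real^2 \<Rightarrow> real" where
  "chart k x = alt_sign k * (perp k x * (par k x - cot al * \<bar>perp k x\<bar>))"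

definition dchart :: "int \<Rightarrow> real^2 \<Rightarrow> real^2 \<Rightarrow> real" where
  "dchart k x h = alt_sign k * (perp k x * par k h + (par k x - 2 * cot al * \<bar>perp k x\<bar>) * perp k h)"

lemma bounded_linear_par: "bounded_linear (par k)" and bounded_linear_perp: "bounded_linear (perp k)"
  unfolding par_def[abs_def] perp_def[abs_def]
  by (intro bounded_linear_add bounded_linear_sub bounded_linear_mult_left[THEN bounded_linear_compose]
      bounded_linear_vec_nth)+

lemma has_derivative_par: "(par k has_derivative par k) (at x)"
  and has_derivative_perp: "(perp k has_derivative perp k) (at x)"
  by (rule bounded_linear_imp_has_derivative[OF bounded_linear_par]
      bounded_linear_imp_has_derivative[OF bounded_linear_perp])+

lemma par_polar: "par k (polar r (of_int k * al + s)) = r * cos s"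
  and perp_polar: "perp k (polar r (of_int k * al + s)) = r * sin s"
proof -
  define t where "t = of_int k * al"
  have "cos s = cos ((t + s) - t)" "sin s = sin ((t + s) - t)" by simp_all
  then have c: "cos s = cos (t + s) * cos t + sin (t + s) * sin t"
    and s: "sin s = sin (t + s) * cos t - cos (t + s) * sin t"
    unfolding cos_diff sin_diff by blast+
  show "par k (polar r (of_int k * al + s)) = r * cos s"
    unfolding par_def t_def[symmetric] c by (simp add: algebra_simps)
  show "perp k (polar r (of_int k * al + s)) = r * sin s"
    unfolding perp_def t_def[symmetric] s by (simp add: algebra_simps)
qed

lemma polar_exists_near:
  obtains s where "-pi < s" "s \<le> pi" "x = polar (norm x) (of_int k * al + s)"
proof -
  obtain \<theta> where \<theta>: "x = polar (norm x) \<theta>" using polar_exists by blast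
  obtain s where s: "-pi < s" "s \<le> pi" "sin s = sin (\<theta> - of_int k * al)" "cos s = cos (\<theta> - of_int k * al)"
    using sincos_principal_value by metis
  have "cos (of_int k * al + s) = cos (of_int k * al + (\<theta> - of_int k * al))"
    "sin (of_int k * al + s) = sin (of_int k * al + (\<theta> - of_int k * al))"
    unfolding cos_add sin_add s(3,4) by blast+
  then have "polar (norm x) (of_int k * al + s) = polar (norm x) \<theta>"
    by (simp add: vec_eq_iff forall_2)
  then show ?thesis using that s \<theta> by metis
qed

text \<open>The open cone of directions within angle \<alpha> of ray k, reaching up to both
  neighbouring rays. These cones overlap and cover the punctured plane, and every ray is interior to
  one of them, as differentiability across it requires.\<close>

definition sector :: "int \<Rightarrow> (real^2) set" where
  "sector k = {x. cos al * norm x < par k x}"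

lemma open_sector: "open (sector k)"
  unfolding sector_def
  by (intro open_Collect_less continuous_intros linear_continuous_on bounded_linear_par)

lemma height_chart:
  assumes "x \<in> sector k"
  shows "height n x = chart k x"
proof -
  obtain s where s: "-pi < s" "s \<le> pi" "x = polar (norm x) (of_int k * al + s)"
    by (rule polar_exists_near)
  have par: "par k x = norm x * cos s" and perp: "perp k x = norm x * sin s"
    using par_polar perp_polar s(3) by metis+
  have "norm x > 0"
  proof (rule ccontr)
    assume "\<not> norm x > 0"
    then have "norm x = 0" by simp
    then show False using assms par by (simp add: sector_def)
  qed
  have "cos al < cos s" using assms \<open>norm x > 0\<close> par by (simp add: sector_def mult.commute)
  have "\<bar>s\<bar> < al"
  proof (rule ccontr)
    assume "\<not> \<bar>s\<bar> < al"
    then have "cos \<bar>s\<bar> \<le> cos al" using al s by (intro cos_monotone_0_pi_le) auto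
    then show False using \<open>cos al < cos s\<close> by (simp add: abs_if split: if_splits)
  qed
  have "height n x = (norm x)\<^sup>2 * wave al (of_int k * al + s)"
    using height_polar[of "norm x" n "of_int k * al + s"] n \<open>norm x > 0\<close> s(3) by simp
  also have "\<dots> = chart k x"
    unfolding wave_near_ray[OF al(1,3) \<open>\<bar>s\<bar> < al\<close>] chart_def par perp
    by (simp add: abs_mult power2_eq_square algebra_simps)
  finally show ?thesis .
qed

lemma sector_exists:
  assumes "x \<noteq> 0"
  obtains k where "x \<in> sector k"
proof -
  obtain \<theta> where \<theta>: "x = polar (norm x) \<theta>" using polar_exists by blast
  define k where "k = \<lfloor>\<theta> / al\<rfloor>"
  define s where "s = \<theta> - of_int k * al"
  have "of_int k \<le> \<theta> / al" "\<theta> / al < of_int k + 1" unfolding k_def by linarith+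
  then have "of_int k * al \<le> \<theta>" "\<theta> < (of_int k + 1) * al"
    using al(1) pos_le_divide_eq[of al "of_int k" \<theta>] pos_divide_less_eq[of al \<theta> "of_int k + 1"] by blast+
  then have s: "0 \<le> s" "s < al" unfolding s_def distrib_right by linarith+
  then have "cos al < cos s" using al by (intro cos_monotone_0_pi) auto
  moreover have "par k x = norm x * cos s"
    using par_polar[of k "norm x" s] \<theta> by (simp add: s_def)
  ultimately have "x \<in> sector k" using assms by (simp add: sector_def mult.commute)
  then show ?thesis by (rule that)
qed

lemma has_derivative_chart: "(chart k has_derivative dchart k x) (at x)"
proof -
  have "((\<lambda>x. perp k x * \<bar>perp k x\<bar>) has_derivative (\<lambda>h. 2 * \<bar>perp k x\<bar> * perp k h)) (at x)"
    using has_derivative_compose[OF has_derivative_perp[of k x], of "\<lambda>t. t * \<bar>t\<bar>" "(*) (2 * \<bar>perp k x\<bar>)"]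
      has_real_derivative_mult_abs[of "perp k x"]
    by (simp add: has_field_derivative_def)
  then have "((\<lambda>x. alt_sign k * (perp k x * par k x - cot al * (perp k x * \<bar>perp k x\<bar>))) has_derivative
     (\<lambda>h. alt_sign k * (perp k x * par k h + perp k h * par k x - cot al * (2 * \<bar>perp k x\<bar> * perp k h)))) (at x)"
    by (intro has_derivative_mult_right has_derivative_diff has_derivative_mult has_derivative_par has_derivative_perp)
  then show ?thesis
    by (simp add: chart_def[abs_def] dchart_def[abs_def] algebra_simps)
qed

definition grad :: "2 \<Rightarrow> real^2 \<Rightarrow> real" where
  "grad j x = frechet_derivative (height n) (at x) (axis j 1)"

text \<open>A classical derivative; on the rays, where the gradient need not be differentiable, its
  value is unspecified.\<close>

definition hess :: "2 \<Rightarrow> 2 \<Rightarrow> real^2 \<Rightarrow> real" where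
  "hess i j x = frechet_derivative (grad i) (at x) (axis j 1)"

lemma has_derivative_height:
  assumes "x \<in> sector k"
  shows "(height n has_derivative dchart k x) (at x)"
  by (rule has_derivative_transform_within_open[OF has_derivative_chart open_sector assms])
    (simp add: height_chart)

lemma grad_sector: "x \<in> sector k \<Longrightarrow> grad j x = dchart k x (axis j 1)"
  unfolding grad_def using frechet_derivative_at[OF has_derivative_height] by metis

lemma locally_lipschitz_chart: "locally_lipschitz_on S (chart k)"
proof -
  have "locally_lipschitz_on S (\<lambda>x. alt_sign k * (perp k x * (par k x + (- cot al) * \<bar>perp k x\<bar>)))"
    by (intro locally_lipschitz_on_mult locally_lipschitz_on_add locally_lipschitz_on_abs
        locally_lipschitz_on_const locally_lipschitz_on_linear bounded_linear_par bounded_linear_perp)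
  then show ?thesis by (simp add: chart_def[abs_def])
qed

lemma locally_lipschitz_dchart: "locally_lipschitz_on S (\<lambda>x. dchart k x h)"
proof -
  have "locally_lipschitz_on S (\<lambda>x. alt_sign k * (perp k x * par k h + (par k x + (- 2 * cot al) * \<bar>perp k x\<bar>) * perp k h))"
    by (intro locally_lipschitz_on_mult locally_lipschitz_on_add locally_lipschitz_on_abs
        locally_lipschitz_on_const locally_lipschitz_on_linear bounded_linear_par bounded_linear_perp)
  then show ?thesis by (simp add: dchart_def[abs_def])
qed

text \<open>Near a nonzero point both functions coincide with those of a single chart, built from
  linear functions and |perp| by sums and products. For the gradient this excludes a singular part
  of the weak Hessian on the rays.\<close>

lemma locally_lipschitz_height: "locally_lipschitz_on (- {0}) (height n)"
  and locally_lipschitz_grad: "locally_lipschitz_on (- {0}) (grad j)"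
proof -
  have "locally_lipschitz_on {x} (height n) \<and> locally_lipschitz_on {x} (grad j)" if "x \<noteq> 0" for x
  proof -
    obtain k where k: "x \<in> sector k" using \<open>x \<noteq> 0\<close> by (rule sector_exists)
    show ?thesis
      using locally_lipschitz_on_transform[OF k open_sector _ locally_lipschitz_chart]
        locally_lipschitz_on_transform[OF k open_sector _ locally_lipschitz_dchart]
        height_chart grad_sector by metis
  qed
  then show "locally_lipschitz_on (- {0}) (height n)" "locally_lipschitz_on (- {0}) (grad j)"
    by (subst locally_lipschitz_on_pointwise, simp)+
qed

lemma differentiable_height: "x \<noteq> 0 \<Longrightarrow> height n differentiable (at x)"
  using sector_exists has_derivative_height unfolding differentiable_def by metis

lemma has_derivative_grad:
  assumes "x \<in> sector k" "perp k x \<noteq> 0"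
  shows "(grad j has_derivative (\<lambda>h. alt_sign k * (perp k h * par k (axis j 1)
     + (par k h - 2 * cot al * (perp k h * sgn (perp k x))) * perp k (axis j 1)))) (at x)"
proof -
  have "((\<lambda>x. \<bar>perp k x\<bar>) has_derivative (\<lambda>h. perp k h * sgn (perp k x))) (at x)"
    using has_derivative_compose[OF has_derivative_perp[of k x], of "\<lambda>t. \<bar>t\<bar>" "(*) (sgn (perp k x))"]
      has_real_derivative_abs[OF assms(2)]
    by (simp add: has_field_derivative_def mult.commute)
  then have "((\<lambda>x. dchart k x (axis j 1)) has_derivative (\<lambda>h. alt_sign k * (perp k h * par k (axis j 1)
     + (par k h - 2 * cot al * (perp k h * sgn (perp k x))) * perp k (axis j 1)))) (at x)"
    unfolding dchart_def
    by (intro has_derivative_mult_right has_derivative_diff has_derivative_add has_derivative_mult_left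
        has_derivative_par has_derivative_perp)
  then show ?thesis
    by (rule has_derivative_transform_within_open[OF _ open_sector assms(1)]) (simp add: grad_sector)
qed

lemma AE_perp_nonzero: "AE x in lebesgue. \<forall>k. perp k x \<noteq> 0"
proof -
  have "AE x in lebesgue. perp k x \<noteq> 0" for k
  proof -
    define v :: "real^2" where "v = vector [- sin (of_int k * al), cos (of_int k * al)]"
    have "v \<noteq> 0"
    proof
      assume "v = 0"
      then have "v$1 = 0" "v$2 = 0" by simp_all
      then show False using sin_cos_squared_add[of "of_int k * al"] by (simp add: v_def)
    qed
    then have "negligible {x. v \<bullet> x = 0}" by (intro negligible_hyperplane) simp
    moreover have "{x. v \<bullet> x = 0} = {x. perp k x = 0}"
      by (simp add: v_def perp_def inner_vec_def sum_2 algebra_simps)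
    ultimately show ?thesis
      using AE_not_in[of "{x. perp k x = 0}" lebesgue] by (simp add: negligible_iff_null_sets)
  qed
  then show ?thesis by (simp add: AE_all_countable)
qed

lemma differentiable_grad:
  assumes "x \<noteq> 0" "\<forall>k. perp k x \<noteq> 0"
  shows "grad j differentiable (at x)"
proof -
  obtain k where "x \<in> sector k" using assms(1) by (rule sector_exists)
  from has_derivative_grad[OF this] assms(2) show ?thesis unfolding differentiable_def by blast
qed

text \<open>In the coordinates \<open>a = par k x\<close> and \<open>b = perp k x\<close>, the height is \<open>\<plusminus>(a b - c b\<^sup>2)\<close> with
  \<open>c = \<plusminus>cot \<alpha>\<close>, a quadratic form whose Hessian has determinant \<open>-1\<close>.\<close>

lemma local_form:
  assumes "x \<noteq> 0" "\<forall>k. perp k x \<noteq> 0"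
  obtains \<sigma> c C S a b :: real where "\<sigma>\<^sup>2 = 1" "c\<^sup>2 = (cot al)\<^sup>2" "C\<^sup>2 + S\<^sup>2 = 1"
    "x$1 = a * C - b * S" "x$2 = a * S + b * C"
    "height n x = \<sigma> * (a * b - c * b\<^sup>2)"
    "grad 1 x = \<sigma> * (b * C - (a - 2 * c * b) * S)"
    "grad 2 x = \<sigma> * (b * S + (a - 2 * c * b) * C)"
    "hess 1 1 x = \<sigma> * (- 2 * C * S - 2 * c * S\<^sup>2)"
    "hess 1 2 x = \<sigma> * (C\<^sup>2 - S\<^sup>2 + 2 * c * C * S)"
    "hess 2 1 x = \<sigma> * (C\<^sup>2 - S\<^sup>2 + 2 * c * C * S)"
    "hess 2 2 x = \<sigma> * (2 * C * S - 2 * c * C\<^sup>2)"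
proof -
  obtain k where k: "x \<in> sector k" using \<open>x \<noteq> 0\<close> by (rule sector_exists)
  define \<sigma> C S where "\<sigma> = alt_sign k" and "C = cos (of_int k * al)" and "S = sin (of_int k * al)"
  \<comment> \<open>On either side of the ray |perp| is perp times a fixed sign. Absorbing this sign
    into c makes the chart an honest quadratic form there.\<close>
  define c where "c = cot al * sgn (perp k x)"
  have b: "perp k x \<noteq> 0" using assms by blast
  have abs: "cot al * \<bar>perp k x\<bar> = c * perp k x" by (simp add: c_def abs_sgn mult.commute)
  have sg: "cot al * (y * sgn (perp k x)) = c * y" for y by (simp add: c_def)
  have par_ax: "par k (axis 1 1) = C" "par k (axis 2 1) = S"
    "perp k (axis 1 1) = - S" "perp k (axis 2 1) = C"
    by (simp_all add: par_def perp_def C_def S_def)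
  have par_x: "par k x = x$1 * C + x$2 * S" "perp k x = x$2 * C - x$1 * S"
    by (simp_all add: par_def perp_def C_def S_def)
  have CS: "C\<^sup>2 + S\<^sup>2 = 1" by (simp add: C_def S_def)
  have hs: "hess i j x = \<sigma> * (perp k (axis j 1) * par k (axis i 1)
     + (par k (axis j 1) - 2 * c * perp k (axis j 1)) * perp k (axis i 1))" for i j
    unfolding hess_def \<sigma>_def frechet_derivative_at[OF has_derivative_grad[OF k b], symmetric]
    using sg[of "perp k (axis j 1)"] by (simp add: mult.assoc)
  have gr: "grad j x = \<sigma> * (perp k x * par k (axis j 1) + (par k x - 2 * c * perp k x) * perp k (axis j 1))" for j
    using abs by (simp add: grad_sector[OF k] dchart_def \<sigma>_def mult.assoc)
  show ?thesis
  proof (rule that[of \<sigma> c C S "par k x" "perp k x"])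
    show "\<sigma>\<^sup>2 = 1" by (simp add: \<sigma>_def alt_sign_def)
    show "c\<^sup>2 = (cot al)\<^sup>2" using b by (simp add: c_def power_mult_distrib sgn_if)
    show "C\<^sup>2 + S\<^sup>2 = 1" by (rule CS)
    have "par k x * C - perp k x * S = x$1 * (C\<^sup>2 + S\<^sup>2)" "par k x * S + perp k x * C = x$2 * (C\<^sup>2 + S\<^sup>2)"
      unfolding par_x by (simp_all add: algebra_simps power2_eq_square)
    then show "x$1 = par k x * C - perp k x * S" "x$2 = par k x * S + perp k x * C"
      unfolding CS by simp_all
    show "height n x = \<sigma> * (par k x * perp k x - c * (perp k x)\<^sup>2)"
      using abs by (simp add: height_chart[OF k] chart_def \<sigma>_def power2_eq_square algebra_simps)
  qed (simp_all add: gr hs par_ax power2_eq_square algebra_simps)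
qed

lemma AE_differentiable_grad: "AE x in lebesgue. x \<in> annulus r0 \<longrightarrow> grad j differentiable (at x)"
  if "r0 > 0"
  using AE_perp_nonzero
  by eventually_elim (use that in \<open>auto intro!: differentiable_grad simp: annulus_def\<close>)

section \<open>The comparison deformation on the annulus and its energy\<close>

context
  fixes r0 :: real
  assumes r0: "0 < r0"
begin

lemma annulus_nonzero: "x \<in> annulus r0 \<Longrightarrow> x \<noteq> 0"
  using r0 by (auto simp: annulus_def)

text \<open>The compact set that \<open>locally_lipschitz_W12\<close> requires between the annulus
  and the punctured plane.\<close>

definition shell :: "(real^2) set" where
  "shell = cball 0 1 - ball 0 r0"

lemma shell: "annulus r0 \<subseteq> shell" "compact shell" "shell \<subseteq> - {0}"
  using r0 by (auto simp: shell_def annulus_def intro!: compact_diff)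

definition disp :: "2 \<Rightarrow> real^2 \<Rightarrow> real" where
  "disp i x = - (1/3) * (height n x * grad i x)"

lemma differentiable_height_annulus: "AE x in lebesgue. x \<in> annulus r0 \<longrightarrow> height n differentiable (at x)"
  using differentiable_height annulus_nonzero by (intro AE_I2) blast

lemma locally_lipschitz_disp: "locally_lipschitz_on (- {0}) (disp i)"
  unfolding disp_def[abs_def]
  by (intro locally_lipschitz_on_mult locally_lipschitz_on_const locally_lipschitz_height locally_lipschitz_grad)

lemma has_derivative_disp:
  assumes "x \<noteq> 0" "\<forall>k. perp k x \<noteq> 0"
  shows "(disp i has_derivative (\<lambda>h. - (1/3) * (height n x * frechet_derivative (grad i) (at x) h
     + frechet_derivative (height n) (at x) h * grad i x))) (at x)"
  unfolding disp_def[abs_def]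
  by (intro has_derivative_mult_right has_derivative_mult)
    (use differentiable_height differentiable_grad assms frechet_derivative_works in blast)+

lemma partial_disp:
  assumes "x \<noteq> 0" "\<forall>k. perp k x \<noteq> 0"
  shows "frechet_derivative (disp i) (at x) (axis j 1) = - (1/3) * (height n x * hess i j x + grad j x * grad i x)"
  unfolding frechet_derivative_at[OF has_derivative_disp[OF assms], symmetric] hess_def grad_def[of j] ..

lemma AE_differentiable_disp: "AE x in lebesgue. x \<in> annulus r0 \<longrightarrow> disp i differentiable (at x)"
  using AE_perp_nonzero
proof eventually_elim
  case (elim x)
  show ?case using has_derivative_disp[OF annulus_nonzero elim] unfolding differentiable_def by blast
qed

lemmas height_W12 = locally_lipschitz_W12[OF open_annulus shell locally_lipschitz_height differentiable_height_annulus]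
lemmas grad_W12 = locally_lipschitz_W12[OF open_annulus shell locally_lipschitz_grad AE_differentiable_grad[OF r0]]
lemmas disp_W12 = locally_lipschitz_W12[OF open_annulus shell locally_lipschitz_disp AE_differentiable_disp]

definition competitor :: deformation where
  "competitor = ((\<lambda>x. \<chi> i. disp i x), height n)"

lemma competitor_admissible: "competitor \<in> admissible r0"
proof -
  have "height n \<in> W22 (annulus r0)"
    unfolding W22_def using height_W12(1,3) grad_W12(4) by (auto simp: grad_def[abs_def])
  moreover have "(\<lambda>x. disp i x) \<in> W12 (annulus r0)" for i
    by (rule disp_W12(4))
  ultimately show ?thesis by (simp add: competitor_def admissible_def)
qed

lemma height_polar_shift: "r > 0 \<Longrightarrow> height n (polar r (\<theta> + al)) = - height n (polar r \<theta>)"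
  using n al wave_shift[OF al(1)] by (simp add: height_polar)

lemma competitor_periodic: "competitor \<in> periodic_admissible r0 n"
proof -
  have "continuous_on (annulus r0) (height n)"
    using locally_lipschitz_on_continuous[OF locally_lipschitz_height] annulus_nonzero
    by (simp add: continuous_at_imp_continuous_on)
  moreover have "height n (polar r (\<theta> + 2 * pi / real n)) = height n (polar r \<theta>) \<and>
      height n (polar r 0) = 0 \<and> height n (polar r al) = 0 \<and>
      height n (polar r (\<theta> - al)) = - height n (polar r \<theta>)" if "r0 < r" for r \<theta>
  proof -
    have r: "r > 0" using that r0 by simp
    have "\<theta> + 2 * pi / real n = \<theta> + al + al" by simp
    moreover have "wave al 0 = 0" by (simp add: wave_def)
    then have 0: "height n (polar r 0) = 0" using height_polar[of r n 0] r n by simp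
    ultimately show ?thesis
      using height_polar_shift[OF r, of 0] height_polar_shift[OF r, of "\<theta> - al"]
        height_polar_shift[OF r, of "\<theta>"] height_polar_shift[OF r, of "\<theta> + al"]
      by (simp only: add_0 diff_add_cancel minus_minus minus_zero simp_thms)
  qed
  ultimately show ?thesis
    using competitor_admissible unfolding periodic_admissible_def competitor_def
    by (auto intro!: exI[of _ "height n"])
qed

lemma AE_weak_partials:
  "AE x in lebesgue. x \<in> annulus r0 \<longrightarrow> (\<forall>i j.
      weak_partial (annulus r0) j (height n) x = grad j x \<and>
      weak_partial (annulus r0) j (weak_partial (annulus r0) i (height n)) x = hess i j x \<and>
      weak_partial (annulus r0) j (disp i) x = - (1/3) * (height n x * hess i j x + grad j x * grad i x))"
proof -
  have h: "has_weak_partial (annulus r0) (height n) j (grad j)" for j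
    using height_W12(3) by (simp add: grad_def[abs_def])
  have g: "has_weak_partial (annulus r0) (grad i) j (hess i j)" for i j
    using grad_W12(3) by (simp add: hess_def[abs_def])
  have 1: "AE x in lebesgue. \<forall>j. x \<in> annulus r0 \<longrightarrow> weak_partial (annulus r0) j (height n) x = grad j x"
    unfolding AE_all_countable by (intro allI weak_partial_AE_eq[OF open_annulus h])
  have 2: "AE x in lebesgue. \<forall>i j. x \<in> annulus r0 \<longrightarrow>
      weak_partial (annulus r0) j (weak_partial (annulus r0) i (height n)) x = hess i j x"
    unfolding AE_all_countable by (intro allI weak_partial_weak_partial(2)[OF open_annulus h g])
  have 3: "AE x in lebesgue. \<forall>i j. x \<in> annulus r0 \<longrightarrow>
      weak_partial (annulus r0) j (disp i) x = frechet_derivative (disp i) (at x) (axis j 1)"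
    unfolding AE_all_countable by (intro allI weak_partial_AE_eq[OF open_annulus disp_W12(3)])
  show ?thesis
    using 1 2 3 AE_perp_nonzero
  proof eventually_elim
    case (elim x)
    then show ?case using partial_disp[OF annulus_nonzero] by simp
  qed
qed

lemma competitor_stretching: "stretching_energy r0 \<nu> competitor = 0"
proof -
  have "AE x in lebesgue. x \<in> annulus r0 \<longrightarrow> elastic_density \<nu> (strain r0 competitor x) = 0"
    using AE_weak_partials AE_perp_nonzero
  proof eventually_elim
    case (elim x)
    show ?case
    proof
      assume x: "x \<in> annulus r0"
      obtain \<sigma> c C S a b where l: "\<sigma>\<^sup>2 = 1" "c\<^sup>2 = (cot al)\<^sup>2" "C\<^sup>2 + S\<^sup>2 = 1"
        "x$1 = a * C - b * S" "x$2 = a * S + b * C"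
        "height n x = \<sigma> * (a * b - c * b\<^sup>2)"
        "grad 1 x = \<sigma> * (b * C - (a - 2 * c * b) * S)"
        "grad 2 x = \<sigma> * (b * S + (a - 2 * c * b) * C)"
        "hess 1 1 x = \<sigma> * (- 2 * C * S - 2 * c * S\<^sup>2)"
        "hess 1 2 x = \<sigma> * (C\<^sup>2 - S\<^sup>2 + 2 * c * C * S)"
        "hess 2 1 x = \<sigma> * (C\<^sup>2 - S\<^sup>2 + 2 * c * C * S)"
        "hess 2 2 x = \<sigma> * (2 * C * S - 2 * c * C\<^sup>2)"
        using annulus_nonzero[OF x] elim(2) by (rule local_form)
      \<comment> \<open>Folding with the local form turns the scalar identities into statements on
        \<open>grad\<close>, \<open>hess\<close>, \<open>height\<close> and the coordinates of
        x.\<close>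
      note q = quadratic_strain_identities[OF l(1,3), of b a c, folded l(4-10,12)]
      have h: "hess 2 1 x = hess 1 2 x" unfolding l(10,11) ..
      have s: "strain r0 competitor x $ i $ j = (grad i x * grad j x - height n x * (hess i j x + hess j i x)) / 3
          - metric_g1 x $ i $ j" for i j
      proof -
        have g: "weak_partial (annulus r0) j (height n) x = grad j x" for j
          using elim(1) x by blast
        have d: "weak_partial (annulus r0) j (disp i) x = - (1/3) * (height n x * hess i j x + grad j x * grad i x)" for i j
          using elim(1) x by blast
        show ?thesis
          unfolding strain_nth competitor_def vec_lambda_beta g d by (simp add: field_simps)
      qed
      have "strain r0 competitor x = 0"
        unfolding vec_eq_iff forall_2 s metric_g1_nth h
        using q by (simp add: power2_eq_square field_simps)
      then show "elastic_density \<nu> (strain r0 competitor x) = 0" by (simp add: elastic_density_eq)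
    qed
  qed
  from set_integral_lebesgue_cong_AE[OF this] show ?thesis
    unfolding stretching_energy_def by simp
qed

text \<open>The density is constant almost everywhere: the squared trace is 4 cot^2 \<alpha> on
  every sector, and the determinant -1 contributes the summand 2.\<close>

lemma competitor_bending:
  "bending_energy r0 \<nu> competitor = (4 * (cot al)\<^sup>2 / (1 - \<nu>) + 2) * measure lebesgue (annulus r0)"
proof -
  let ?c = "4 * (cot al)\<^sup>2 / (1 - \<nu>) + 2"
  have "AE x in lebesgue. x \<in> annulus r0 \<longrightarrow>
      elastic_density \<nu> (weak_hessian (annulus r0) (height n) x) = ?c"
    using AE_weak_partials AE_perp_nonzero
  proof eventually_elim
    case (elim x)
    show ?case
    proof
      assume x: "x \<in> annulus r0"
      obtain \<sigma> c C S a b where l: "\<sigma>\<^sup>2 = 1" "c\<^sup>2 = (cot al)\<^sup>2" "C\<^sup>2 + S\<^sup>2 = 1"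
        "x$1 = a * C - b * S" "x$2 = a * S + b * C"
        "height n x = \<sigma> * (a * b - c * b\<^sup>2)"
        "grad 1 x = \<sigma> * (b * C - (a - 2 * c * b) * S)"
        "grad 2 x = \<sigma> * (b * S + (a - 2 * c * b) * C)"
        "hess 1 1 x = \<sigma> * (- 2 * C * S - 2 * c * S\<^sup>2)"
        "hess 1 2 x = \<sigma> * (C\<^sup>2 - S\<^sup>2 + 2 * c * C * S)"
        "hess 2 1 x = \<sigma> * (C\<^sup>2 - S\<^sup>2 + 2 * c * C * S)"
        "hess 2 2 x = \<sigma> * (2 * C * S - 2 * c * C\<^sup>2)"
        using annulus_nonzero[OF x] elim(2) by (rule local_form)
      have q: "(hess 1 1 x + hess 2 2 x)\<^sup>2 = 4 * (cot al)\<^sup>2" "hess 1 1 x * hess 2 2 x - hess 1 2 x * hess 2 1 x = -1"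
        using quadratic_hessian_identities[OF l(1,3), of c] unfolding l(2,9-12) by (simp_all add: power2_eq_square)
      have "weak_hessian (annulus r0) (height n) x $ i $ j = hess i j x" for i j
        using elim(1) x by (simp add: weak_hessian_def)
      then show "elastic_density \<nu> (weak_hessian (annulus r0) (height n) x) = ?c"
        by (simp only: elastic_density_eq q) simp
    qed
  qed
  from set_integral_lebesgue_cong_AE[OF this]
  have "bending_energy r0 \<nu> competitor = (LINT x:annulus r0|lebesgue. ?c)"
    by (simp add: bending_energy_def competitor_def)
  also have "\<dots> = ?c * measure lebesgue (annulus r0)"
    by (simp add: set_lebesgue_integral_def mult.commute)
  finally show ?thesis .
qed

text \<open>The function sin x - x cos x has derivative x sin x \<ge> 0 on the interval and vanishes
  at 0. Hence \<alpha> cos \<alpha> \<le> sin \<alpha>, which gives cot \<alpha> \<le> 1/\<alpha> =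
  n/pi.\<close>

lemma cot_le: "0 \<le> cot al" "cot al \<le> real n"
proof -
  have s: "sin al > 0" using al by (intro sin_gt_zero) auto
  have "cos al \<ge> 0" using al by (intro cos_ge_zero) auto
  then show "0 \<le> cot al" using s by (simp add: cot_def)
  have "sin 0 - 0 * cos 0 \<le> sin al - al * cos al"
  proof (rule DERIV_nonneg_imp_nondecreasing[where f = "\<lambda>x. sin x - x * cos x"])
    fix x assume x: "0 \<le> x" "x \<le> al"
    have "((\<lambda>x. sin x - x * cos x) has_real_derivative x * sin x) (at x)"
      by (auto intro!: derivative_eq_intros)
    moreover have "0 \<le> x * sin x" using x al by (intro mult_nonneg_nonneg sin_ge_zero) auto
    ultimately show "\<exists>y. ((\<lambda>x. sin x - x * cos x) has_real_derivative y) (at x) \<and> 0 \<le> y" by blast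
  qed (use al in simp)
  then have "al * cos al \<le> sin al" by simp
  moreover have "c / s \<le> 1 / a" if "a * c \<le> s" "0 < s" "0 < a" for a c s :: real
    using that by (simp add: field_simps)
  ultimately have "cot al \<le> 1 / al" using s al(1) unfolding cot_def by blast
  also have "\<dots> = real n / pi" by simp
  also have "\<dots> \<le> real n" using n pi_ge_two by (simp add: divide_le_eq)
  finally show "cot al \<le> real n" .
qed

text \<open>The constant 9 is 8 + 1: \<nu> \<le> 1/2 bounds 4 cot^2 \<alpha> / (1 - \<nu>) by 8 n^2,
  and the summand 2 is at most n^2.\<close>

lemma competitor_energy_le:
  assumes "-1 < \<nu>" "\<nu> \<le> 1/2"
  shows "energy r0 \<nu> \<tau> competitor \<le> 9 * measure lebesgue (annulus r0) * (real n)\<^sup>2 * \<tau>\<^sup>2"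
proof -
  have "(cot al)\<^sup>2 \<le> (real n)\<^sup>2" using cot_le by (rule power_mono[rotated])
  then have "4 * (cot al)\<^sup>2 / (1 - \<nu>) \<le> 4 * (real n)\<^sup>2 / (1/2)"
    using assms by (intro frac_le) auto
  then have "4 * (cot al)\<^sup>2 / (1 - \<nu>) \<le> 8 * (real n)\<^sup>2" by simp
  moreover have "2 \<le> (real n)\<^sup>2"
  proof -
    have "2 * 1 \<le> real n * real n" using n by (intro mult_mono) auto
    then show ?thesis by (simp add: power2_eq_square)
  qed
  ultimately have "4 * (cot al)\<^sup>2 / (1 - \<nu>) + 2 \<le> 9 * (real n)\<^sup>2" by linarith
  then have "(4 * (cot al)\<^sup>2 / (1 - \<nu>) + 2) * measure lebesgue (annulus r0)
      \<le> 9 * (real n)\<^sup>2 * measure lebesgue (annulus r0)"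
    by (rule mult_right_mono) simp
  then have "\<tau>\<^sup>2 * bending_energy r0 \<nu> competitor \<le> \<tau>\<^sup>2 * (9 * (real n)\<^sup>2 * measure lebesgue (annulus r0))"
    unfolding competitor_bending by (rule mult_left_mono) simp
  then show ?thesis by (simp add: energy_def competitor_stretching mult_ac)
qed

end

end

theorem lemma1p2:
  fixes r0 \<nu> :: real
  assumes "0 < r0" "r0 < 1" "-1 < \<nu>" "\<nu> \<le> 1/2"
  shows "\<exists>C::real. \<forall>n::nat. \<forall>\<tau>::real. \<forall>d. n \<ge> 2 \<longrightarrow> \<tau> > 0 \<longrightarrow>
           d \<in> periodic_admissible r0 n \<longrightarrow>
           energy r0 \<nu> \<tau> d = (INF d'\<in>periodic_admissible r0 n. energy r0 \<nu> \<tau> d') \<longrightarrow>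
           energy r0 \<nu> \<tau> d \<le> min (C * (real n)\<^sup>2 * \<tau>\<^sup>2) (flat_energy r0 \<nu> \<tau>)"
proof (intro exI allI impI)
  fix n :: nat and \<tau> :: real and d
  assume n: "n \<ge> 2"
    and d: "energy r0 \<nu> \<tau> d = (INF d'\<in>periodic_admissible r0 n. energy r0 \<nu> \<tau> d')"
  have "0 \<le> energy r0 \<nu> \<tau> d'" if "d' \<in> periodic_admissible r0 n" for d'
    using energy_nonneg[of \<nu> d' r0 \<tau>] assms that periodic_admissible_subset by force
  \<comment> \<open>Without a lower bound the real infimum would be an unspecified number; this is
    where nonnegativity of the energies is used.\<close>
  then have bdd: "bdd_below (energy r0 \<nu> \<tau> ` periodic_admissible r0 n)"
    by (intro bdd_belowI2[of _ 0])
  have "energy r0 \<nu> \<tau> d \<le> energy r0 \<nu> \<tau> (competitor n)"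
    unfolding d by (rule cINF_lower[OF bdd competitor_periodic[OF n assms(1)]])
  also have "\<dots> \<le> 9 * measure lebesgue (annulus r0) * (real n)\<^sup>2 * \<tau>\<^sup>2"
    by (rule competitor_energy_le[OF n assms(1,3,4)])
  finally have "energy r0 \<nu> \<tau> d \<le> 9 * measure lebesgue (annulus r0) * (real n)\<^sup>2 * \<tau>\<^sup>2" .
  moreover have "energy r0 \<nu> \<tau> d \<le> flat_energy r0 \<nu> \<tau>"
    unfolding d flat_energy_def
    by (rule cINF_superset_mono[OF flat_admissible_nonempty bdd flat_subset_periodic order_refl])
  ultimately show "energy r0 \<nu> \<tau> d \<le> min (9 * measure lebesgue (annulus r0) * (real n)\<^sup>2 * \<tau>\<^sup>2) (flat_energy r0 \<nu> \<tau>)"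
    by simp
qed

end
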